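(* Let $A,E\in\mathbb{R}^{n\times n}$ with $\det E\neq 0$, let $B\in\mathbb{R}^{n\times m}$, and assume that all eigenvalues of $E^{-1}A$ lie in the open left half of the complex plane. Let $\sigma_1,\dots,\sigma_k\in\mathbb{C}$ be pairwise distinct shifts with $\mathrm{Re}(\sigma_i)>0$ such that the set $\{\sigma_1,\dots,\sigma_k\}$ is closed under complex conjugation, and put $q=km$. Let $Z\in\mathbb{C}^{n\times q}$ be the ADI basis for $(\sigma_1,\dots,\sigma_k)$, assume that the rational input block Krylov subspace $\mathcal{K}(A,B,\sigma)$ has dimension $q$, and let $V\in\mathbb{R}^{n\times q}$ be a real matrix whose columns form a basis of it. Let $W\in\mathbb{R}^{n\times q}$ be such that, with $A_q:=W^TAV$, $E_q:=W^TEV$, $B_q:=W^TB$, the matrix $E_q$ is nonsingular and the projected Lyapunov equation $A_qP_qE_q^T+E_qP_qA_q^T+B_qB_q^T=0$ has a solution $P_q\in\mathbb{R}^{q\times q}$ with $VP_qV^T=ZZ^*$. Let $C\in\mathbb{R}^{p\times n}$ be an arbitrary output matrix, $C_q:=CV$, $G(s)=C(sE-A)^{-1}B$ and $G_q(s)=C_q(sE_q-A_q)^{-1}B_q$. Then $G_q$ is an $\mathcal{H}_2$ pseudo-optimal approximation of $G$, i.e. $$\|G-G_q\|_{\mathcal{H}_2}=\min_{\widetilde G_q\in\mathcal{T}^{(p,m)}_{(A_q,E_q)}}\|G-\widetilde G_q\|_{\mathcal{H}_2},$$ where $\mathcal{T}^{(p,m)}_{(A_q,E_q)}$ is the set of all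 systems $\widetilde G_q(s)=\widetilde C_q(s\widetilde E_q-\widetilde A_q)^{-1}\widetilde B_q$ with $\widetilde A_q,\widetilde E_q\in\mathbb{R}^{q\times q}$, $\widetilde E_q$ nonsingular, such that $\widetilde E_q^{-1}\widetilde A_q$ and $E_q^{-1}A_q$ have the same Jordan canonical form, and with $\widetilde B_q\in\mathbb{R}^{q\times m}$ and $\widetilde C_q\in\mathbb{R}^{p\times q}$ arbitrary.
   Context: ${}^*$ denotes conjugate transpose. The ADI basis for a sequence of shifts $(\sigma_1,\dots,\sigma_k)$ in the open right half plane is $Z=[Z_1,\dots,Z_k]\in\mathbb{C}^{n\times km}$, with blocks $Z_i\in\mathbb{C}^{n\times m}$ defined by $$Z_1=\sqrt{2\,\mathrm{Re}(\sigma_1)}\,(A-\sigma_1E)^{-1}B,$$ $$Z_i=\sqrt{\frac{\mathrm{Re}(\sigma_i)}{\mathrm{Re}(\sigma_{i-1})}}\left(I+(\sigma_i+\overline{\sigma_{i-1}})(A-\sigma_iE)^{-1}E\right)Z_{i-1},\qquad i=2,\dots,k.$$ The rational input block Krylov subspace is $$\mathcal{K}(A,B,\sigma)=\mathrm{span}\{(A-\sigma_1E)^{-1}B,\dots,(A-\sigma_kE)^{-1}B\},$$ the span of all columns of the listed matrices. It is a subspace of $\mathbb{C}^n$, and it has a real basis when the set of shifts is closed under complex conjugation. The $\mathcal{H}_2$ norm of an asymptotically stable system with transfer function $G(s)$ is defined by $$\|G\|_{\mathcal{H}_2}^2=\frac{1}{2\pi}\int_{-\infty}^{\infty}\mathrm{trace}\left(\overline{G(j\omega)}\,G(j\omega)^T\right)d\omega,$$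 where $j$ is the imaginary unit. *)

theory Defs
  imports
    "HOL-Analysis.Lebesgue_Measure"
    "HOL-Analysis.Bochner_Integration"
    "Jordan_Normal_Form.Gauss_Jordan_Elimination"
    "Jordan_Normal_Form.Jordan_Normal_Form_Existence"
begin

abbreviation cmat :: "real mat \<Rightarrow> complex mat" where
  "cmat \<equiv> map_mat complex_of_real"

text \<open>Meaningful for invertible square matrices only; otherwise \<^term>\<open>mat_inverse M\<close> is \<^term>\<open>None\<close>.\<close>
definition minv :: "'a :: field mat \<Rightarrow> 'a mat" where
  "minv M = the (mat_inverse M)"

definition mat_trace :: "'a :: comm_monoid_add mat \<Rightarrow> 'a" where
  "mat_trace M = (\<Sum>i<dim_row M. M $$ (i, i))"

definition asymp_stable :: "real mat \<Rightarrow> real mat \<Rightarrow> bool" where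
  "asymp_stable A E \<longleftrightarrow> (\<forall>\<mu>. eigenvalue (cmat (minv E * A)) \<mu> \<longrightarrow> Re \<mu> < 0)"

text \<open>Shifts are indexed from \<open>0\<close>: \<open>\<sigma> i\<close> for \<open>i < k\<close>.\<close>
primrec adi_block ::
  "complex mat \<Rightarrow> complex mat \<Rightarrow> complex mat \<Rightarrow> (nat \<Rightarrow> complex) \<Rightarrow> nat \<Rightarrow> complex mat" where
  "adi_block A E B \<sigma> 0 =
     complex_of_real (sqrt (2 * Re (\<sigma> 0))) \<cdot>\<^sub>m (minv (A - \<sigma> 0 \<cdot>\<^sub>m E) * B)"
| "adi_block A E B \<sigma> (Suc i) =
     complex_of_real (sqrt (Re (\<sigma> (Suc i)) / Re (\<sigma> i))) \<cdot>\<^sub>m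
       ((1\<^sub>m (dim_row A) + (\<sigma> (Suc i) + cnj (\<sigma> i)) \<cdot>\<^sub>m (minv (A - \<sigma> (Suc i) \<cdot>\<^sub>m E) * E))
         * adi_block A E B \<sigma> i)"

text \<open>The horizontal concatenation of the first \<open>k\<close> blocks, each with \<open>m = dim_col B\<close> columns.\<close>
definition adi_basis ::
  "complex mat \<Rightarrow> complex mat \<Rightarrow> complex mat \<Rightarrow> (nat \<Rightarrow> complex) \<Rightarrow> nat \<Rightarrow> complex mat" where
  "adi_basis A E B \<sigma> k = Matrix.mat (dim_row A) (k * dim_col B)
     (\<lambda>(r, c). adi_block A E B \<sigma> (c div dim_col B) $$ (r, c mod dim_col B))"

definition krylov ::
  "complex mat \<Rightarrow> complex mat \<Rightarrow> complex mat \<Rightarrow> (nat \<Rightarrow> complex) \<Rightarrow> nat \<Rightarrow> complex Matrix.vec set" where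
  "krylov A E B \<sigma> k = LinearCombinations.module.span class_ring (module_vec TYPE(complex) (dim_row A))
     (\<Union>i<k. set (cols (minv (A - \<sigma> i \<cdot>\<^sub>m E) * B)))"

text \<open>A subspace \<open>U\<close> of complex \<open>n\<close>-space as a vector space in its own right.\<close>
abbreviation subspace_vs :: "nat \<Rightarrow> complex Matrix.vec set \<Rightarrow> (complex, complex Matrix.vec) Module.module" where
  "subspace_vs n U \<equiv> (module_vec TYPE(complex) n)\<lparr>carrier := U\<rparr>"

definition columns_form_basis :: "complex mat \<Rightarrow> complex Matrix.vec set \<Rightarrow> bool" where
  "columns_form_basis V U \<longleftrightarrow> distinct (cols V) \<and>
     vectorspace.basis class_ring (subspace_vs (dim_row V) U) (set (cols V))"

text \<open>A system is represented by its transfer function; its values at poles are irrelevant.\<close>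
definition transfer_fun :: "real mat \<Rightarrow> real mat \<Rightarrow> real mat \<Rightarrow> real mat \<Rightarrow> complex \<Rightarrow> complex mat" where
  "transfer_fun A E B C s = cmat C * minv (s \<cdot>\<^sub>m cmat E - cmat A) * cmat B"

text \<open>Intended for strictly proper \<open>G\<close> without poles in the closed right half plane,
  for which the integrand is real, nonnegative and integrable.\<close>
definition h2_norm :: "(complex \<Rightarrow> complex mat) \<Rightarrow> real" where
  "h2_norm G = sqrt (1 / (2 * pi) *
     Re (\<integral>\<omega>. mat_trace (map_mat cnj (G (\<i> * complex_of_real \<omega>))
                   * transpose_mat (G (\<i> * complex_of_real \<omega>))) \<partial>lborel))"

definition same_jordan_form :: "complex mat \<Rightarrow> complex mat \<Rightarrow> bool" where
  "same_jordan_form M N \<longleftrightarrow> (\<exists>n_as. jordan_nf M n_as \<and> jordan_nf N n_as)"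

definition systems_same_jordan ::
  "nat \<Rightarrow> nat \<Rightarrow> real mat \<Rightarrow> real mat \<Rightarrow> (complex \<Rightarrow> complex mat) set" where
  "systems_same_jordan p m A E =
     {transfer_fun A' E' B' C' | A' E' B' C'.
        A' \<in> carrier_mat (dim_row A) (dim_row A) \<and> E' \<in> carrier_mat (dim_row A) (dim_row A) \<and>
        B' \<in> carrier_mat (dim_row A) m \<and> C' \<in> carrier_mat p (dim_row A) \<and>
        Determinant.det E' \<noteq> 0 \<and>
        same_jordan_form (cmat (minv E' * A')) (cmat (minv E * A))}"

text \<open>The first conjunct makes the norms below meaningful: every system in the set then has
  all its poles in the open left half plane.\<close>
definition h2_pseudo_optimal ::
  "nat \<Rightarrow> nat \<Rightarrow> (complex \<Rightarrow> complex mat) \<Rightarrow> real mat \<Rightarrow> real mat \<Rightarrow> (complex \<Rightarrow> complex mat) \<Rightarrow> bool" where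
  "h2_pseudo_optimal p m G A E Gq \<longleftrightarrow>
     asymp_stable A E \<and>
     is_arg_min (\<lambda>H. h2_norm (\<lambda>s. G s - H s)) (\<lambda>H. H \<in> systems_same_jordan p m A E) Gq"

end

theory Submission
  imports Defs
    "HOL-Complex_Analysis.Complex_Analysis"
    "HOL-Probability.Sinc_Integral"
    "HOL-Real_Asymp.Real_Asymp"
begin

text \<open>
  Write \<open>J = E\<^sub>q\<^sup>-\<^sup>1 A\<^sub>q\<close>. The proof has an algebraic half, which shows that
  \<open>J\<close> is similar to the diagonal matrix with entries \<open>- cnj (\<sigma> i)\<close>, each repeated \<open>m\<close> times, and an
  analytic half, which turns this into an orthogonality relation in \<open>H\<^sub>2\<close>.

  Algebra. The ADI basis satisfies \<open>A Z = E Z S + B L\<close>, where \<open>S\<close> is upper triangular with the shifts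
  on its diagonal and \<open>S + S\<^sup>* = L\<^sup>* L\<close> (\<open>adi_basis_sylvester\<close>, \<open>adi_shift_plus_adjoint\<close>). Eigenvectors
  of \<open>S\<close> recombine the columns of \<open>Z\<close> into the generators of the Krylov subspace. Since \<open>V\<close> is a basis of that
  subspace, \<open>Z = V T\<close> with \<open>T\<close> invertible, and \<open>V P V\<^sup>T = Z Z\<^sup>*\<close> then gives \<open>P = T T\<^sup>*\<close>. Projecting the
  Sylvester equation yields \<open>A\<^sub>q T = E\<^sub>q T S + B\<^sub>q L\<close>. Inserted into the projected Lyapunov equation this
  completes a square: the left-hand side becomes \<open>(B\<^sub>q + E\<^sub>q T L\<^sup>*) (B\<^sub>q + E\<^sub>q T L\<^sup>*)\<^sup>*\<close>, so
  \<open>B\<^sub>q = - E\<^sub>q T L\<^sup>*\<close> and \<open>A\<^sub>q T = - E\<^sub>q T S\<^sup>*\<close> (\<open>lyapunov_square_completion\<close>). As \<open>S\<close> is diagonalizable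
  with eigenvalues \<open>\<sigma> i\<close>, the eigenvalues of \<open>J\<close> are the mirror images \<open>- cnj (\<sigma> i)\<close> of the shifts and are all
  semisimple (\<open>reduced_pencil_structure\<close>).

  Analysis. Every system whose state matrix has the Jordan form of \<open>J\<close> therefore has the form
  \<open>\<Sum> R\<^sub>i / (s + cnj (\<sigma> i))\<close> (\<open>transfer_fun_partial_fractions\<close>). For a stable strictly proper \<open>f\<close>, Cauchy's
  formula says that the \<open>H\<^sub>2\<close> inner product of \<open>f\<close> with \<open>1 / (s + cnj z)\<close> is the value \<open>f z\<close>; the case
  \<open>f z = 0\<close> is \<open>axis_integral_eq_0\<close>. The columns of \<open>V\<close> span the Krylov directions, so \<open>G\<^sub>q\<close> interpolates \<open>G\<close>
  at all shifts (\<open>krylov_basis_interpolation\<close>). Hence \<open>G - G\<^sub>q\<close> is orthogonal to \<open>H - G\<^sub>q\<close> for every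
  competitor \<open>H\<close>, and the theorem of Pythagoras shows that \<open>G\<^sub>q\<close> is the best one.
\<close>

section \<open>Strictly proper stable functions on the imaginary axis\<close>

text \<open>
  The class of transfer function entries for which the inner product on the imaginary axis and Cauchy's formula
  make sense: no poles in the closed right half plane, and decay of order \<open>1 / s\<close> there.
\<close>

definition stable_proper :: "(complex \<Rightarrow> complex) \<Rightarrow> bool" where
  "stable_proper f \<longleftrightarrow> f holomorphic_on {s. 0 \<le> Re s} \<and>
     (\<exists>c R. \<forall>s. 0 \<le> Re s \<and> R \<le> cmod s \<longrightarrow> cmod s * cmod (f s) \<le> c)"

text \<open>
  The decay at infinity and compactness of a half disc combine into one bound that is valid on the whole half plane.
\<close>

lemma stable_proper_bound:
  assumes "stable_proper f"
  obtains c where "0 \<le> c" "\<And>s. 0 \<le> Re s \<Longrightarrow> (1 + cmod s) * cmod (f s) \<le> c"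
proof -
  let ?H = "{s. 0 \<le> Re s}"
  obtain c R where cR: "\<And>s. 0 \<le> Re s \<Longrightarrow> R \<le> cmod s \<Longrightarrow> cmod s * cmod (f s) \<le> c"
    using assms unfolding stable_proper_def by blast
  have cont: "continuous_on ?H f"
    using assms holomorphic_on_imp_continuous_on unfolding stable_proper_def by blast
  let ?R = "max R 1"
  have "compact (?H \<inter> cball 0 ?R)"
    by (intro closed_Int_compact closed_halfspace_Re_ge compact_cball)
  then have "bounded (f ` (?H \<inter> cball 0 ?R))"
    by (intro compact_imp_bounded compact_continuous_image continuous_on_subset[OF cont]) auto
  then obtain b where b: "\<And>s. 0 \<le> Re s \<Longrightarrow> cmod s \<le> ?R \<Longrightarrow> cmod (f s) \<le> b"
    unfolding bounded_iff by (metis IntI image_eqI mem_Collect_eq mem_cball_0)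
  have b0: "0 \<le> b" using order_trans[OF norm_ge_zero b[of 0]] by simp
  \<comment> \<open>Outside the half disc, \<open>cmod s \<ge> 1\<close> and so \<open>1 + cmod s \<le> 2 * cmod s\<close>.\<close>
  let ?c = "max ((1 + ?R) * b) (2 * c)"
  show thesis
  proof (rule that[of ?c])
    have "0 \<le> (1 + ?R) * b" using b0 by (intro mult_nonneg_nonneg) auto
    then show "0 \<le> ?c" by linarith
    fix s :: complex assume s: "0 \<le> Re s"
    show "(1 + cmod s) * cmod (f s) \<le> ?c"
    proof (cases "cmod s \<le> ?R")
      case True
      then have "(1 + cmod s) * cmod (f s) \<le> (1 + ?R) * b"
        using b[OF s] b0 by (intro mult_mono) auto
      then show ?thesis by linarith
    next
      case False
      then have "(1 + cmod s) * cmod (f s) \<le> (2 * cmod s) * cmod (f s)"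
        by (intro mult_right_mono) auto
      also have "\<dots> \<le> 2 * c" using cR[OF s] False by simp
      finally show ?thesis by linarith
    qed
  qed
qed

lemma stable_proper_diff:
  assumes "stable_proper f" "stable_proper g"
  shows "stable_proper (\<lambda>s. f s - g s)"
proof -
  obtain c where c: "\<And>s. 0 \<le> Re s \<Longrightarrow> (1 + cmod s) * cmod (f s) \<le> c"
    using stable_proper_bound[OF assms(1)] by metis
  obtain d where d: "\<And>s. 0 \<le> Re s \<Longrightarrow> (1 + cmod s) * cmod (g s) \<le> d"
    using stable_proper_bound[OF assms(2)] by metis
  have "cmod s * cmod (f s - g s) \<le> c + d" if "0 \<le> Re s" for s
  proof -
    have "cmod s * cmod (f s - g s) \<le> (1 + cmod s) * (cmod (f s) + cmod (g s))"
      by (intro mult_mono norm_triangle_ineq4) auto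
    also have "\<dots> \<le> c + d" using c[OF that] d[OF that] by (simp add: algebra_simps)
    finally show ?thesis .
  qed
  then show ?thesis
    using assms unfolding stable_proper_def by (auto intro!: holomorphic_intros)
qed

lemma stable_proper_cmult:
  assumes "stable_proper f"
  shows "stable_proper (\<lambda>s. a * f s)"
proof -
  obtain c where c: "\<And>s. 0 \<le> Re s \<Longrightarrow> (1 + cmod s) * cmod (f s) \<le> c"
    using stable_proper_bound[OF assms(1)] by metis
  have "cmod s * cmod (a * f s) \<le> cmod a * c" if "0 \<le> Re s" for s
  proof -
    have "cmod s * cmod (a * f s) = cmod a * (cmod s * cmod (f s))" by (simp add: norm_mult)
    also have "\<dots> \<le> cmod a * ((1 + cmod s) * cmod (f s))"
      by (intro mult_left_mono mult_right_mono) auto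
    also have "\<dots> \<le> cmod a * c" using c[OF that] by (intro mult_left_mono) auto
    finally show ?thesis .
  qed
  then show ?thesis
    using assms unfolding stable_proper_def by (auto intro!: holomorphic_intros)
qed

lemma stable_proper_sum:
  assumes "\<And>i. i \<in> I \<Longrightarrow> stable_proper (f i)"
  shows "stable_proper (\<lambda>s. \<Sum>i\<in>I. f i s)"
  using assms
proof (induction I rule: infinite_finite_induct)
  case (insert i I)
  have "stable_proper (\<lambda>s. f i s - (-1) * (\<Sum>i\<in>I. f i s))"
    using insert by (intro stable_proper_diff stable_proper_cmult) auto
  then show ?case using insert by simp
qed (auto simp: stable_proper_def)

lemma stable_proper_simple_pole:
  assumes "Re d < 0"
  shows "stable_proper (\<lambda>s. 1 / (s - d))"
proof -
  have "cmod s * cmod (1 / (s - d)) \<le> 2" if "2 * cmod d + 1 \<le> cmod s" for s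
  proof -
    have "cmod s \<le> 2 * cmod (s - d)" using norm_triangle_ineq2[of s d] that by linarith
    moreover have "s \<noteq> d"
    proof
      assume "s = d"
      then have "2 * cmod d + 1 \<le> cmod d" using that by simp
      then show False using norm_ge_zero[of d] by linarith
    qed
    ultimately show ?thesis by (simp add: norm_divide field_simps)
  qed
  then show ?thesis
    using assms unfolding stable_proper_def
    by (intro conjI exI[of _ 2] exI[of _ "2 * cmod d + 1"]) (auto intro!: holomorphic_intros)
qed

lemma stable_proper_continuous_on_axis:
  assumes "stable_proper f"
  shows "continuous_on UNIV (\<lambda>\<omega>. f (\<i> * complex_of_real \<omega>))"
proof -
  have "continuous_on {s. 0 \<le> Re s} f"
    using assms holomorphic_on_imp_continuous_on unfolding stable_proper_def by blast
  then show ?thesis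
    by (rule continuous_on_compose2) (auto intro: continuous_intros)
qed

lemma integrable_inverse_1_plus_square_UNIV: "integrable lborel (\<lambda>x::real. 1 / (1 + x\<^sup>2))"
  using integrable_inverse_1_plus_square by (simp add: set_integrable_def divide_inverse)

lemma stable_proper_integrable_axis:
  assumes f: "stable_proper f" and g: "stable_proper g"
  shows "integrable lborel (\<lambda>\<omega>. f (\<i> * complex_of_real \<omega>) * cnj (g (\<i> * complex_of_real \<omega>)))"
proof -
  obtain c where c0: "0 \<le> c" and c: "\<And>s. 0 \<le> Re s \<Longrightarrow> (1 + cmod s) * cmod (f s) \<le> c"
    using stable_proper_bound[OF assms(1)] by metis
  obtain d where d: "\<And>s. 0 \<le> Re s \<Longrightarrow> (1 + cmod s) * cmod (g s) \<le> d"
    using stable_proper_bound[OF assms(2)] by metis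
  show ?thesis
  proof (rule Bochner_Integration.integrable_bound)
    show "integrable lborel (\<lambda>\<omega>::real. c * d * (1 / (1 + \<omega>\<^sup>2)))"
      using integrable_inverse_1_plus_square_UNIV by (intro integrable_mult_right) auto
    show "(\<lambda>\<omega>. f (\<i> * complex_of_real \<omega>) * cnj (g (\<i> * complex_of_real \<omega>))) \<in> borel_measurable lborel"
      using stable_proper_continuous_on_axis[OF f] stable_proper_continuous_on_axis[OF g]
      by (simp del: continuous_on_cnj add: borel_measurable_continuous_onI continuous_on_mult continuous_on_cnj)
    show "AE \<omega> in lborel. norm (f (\<i> * complex_of_real \<omega>) * cnj (g (\<i> * complex_of_real \<omega>)))
        \<le> norm (c * d * (1 / (1 + \<omega>\<^sup>2)))"
    proof (rule AE_I2)
      fix \<omega> :: real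
      let ?s = "\<i> * complex_of_real \<omega>"
      have "((1 + cmod ?s) * cmod (f ?s)) * ((1 + cmod ?s) * cmod (g ?s)) \<le> c * d"
        using c[of ?s] d[of ?s] c0 by (intro mult_mono) auto
      moreover have "1 + \<omega>\<^sup>2 \<le> (1 + cmod ?s)\<^sup>2"
        by (simp add: norm_mult power2_sum)
      then have "(1 + \<omega>\<^sup>2) * (cmod (f ?s) * cmod (g ?s)) \<le> (1 + cmod ?s)\<^sup>2 * (cmod (f ?s) * cmod (g ?s))"
        by (intro mult_right_mono) auto
      ultimately have "(1 + \<omega>\<^sup>2) * (cmod (f ?s) * cmod (g ?s)) \<le> c * d"
        by (simp add: power2_eq_square algebra_simps)
      then have "cmod (f ?s) * cmod (g ?s) \<le> c * d * (1 / (1 + \<omega>\<^sup>2))"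
        by (simp add: field_simps add_pos_nonneg)
      then show "norm (f ?s * cnj (g ?s)) \<le> norm (c * d * (1 / (1 + \<omega>\<^sup>2)))"
        using abs_ge_self[of "c * d * (1 / (1 + \<omega>\<^sup>2))"] by (simp only: norm_mult complex_mod_cnj real_norm_def)
    qed
  qed
qed

text \<open>
  Cauchy's integral formula on the boundary of a half disc of radius \<open>R\<close> that contains the zero \<open>z\<close> of \<open>f\<close>: the
  integral over the diameter is minus the integral over the arc, which has length \<open>\<pi> R\<close>.
\<close>

lemma half_disc_integral_bound:
  assumes f: "f holomorphic_on {s. 0 \<le> Re s}" and z: "0 < Re z" and f0: "f z = 0"
    and R: "cmod z < R" and B: "\<And>s. 0 \<le> Re s \<Longrightarrow> cmod s = R \<Longrightarrow> cmod (f s / (s - z)) \<le> B"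
  shows "cmod (integral {-R..R} (\<lambda>\<omega>. f (\<i> * complex_of_real \<omega>) / (\<i> * complex_of_real \<omega> - z)))
    \<le> B * R * pi"
proof -
  let ?H = "{s. 0 \<le> Re s}"
  let ?F = "\<lambda>s. f s / (s - z)"
  \<comment> \<open>The arc from \<open>- \<i> R\<close> to \<open>\<i> R\<close>, closed by the diameter traversed downwards.\<close>
  let ?a = "part_circlepath 0 R (-(pi/2)) (pi/2)" and ?l = "linepath (\<i> * complex_of_real R) (- (\<i> * complex_of_real R))"
  have R0: "0 < R" using R norm_ge_zero le_less_trans by blast
  have ends: "pathstart ?a = - (\<i> * complex_of_real R)" "pathfinish ?a = \<i> * complex_of_real R"
    by (auto simp: exp_eq_polar cis.ctr complex_eq_iff)
  have ima: "path_image ?a \<subseteq> {s. 0 \<le> Re s \<and> cmod s = R}"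
  proof
    fix s assume "s \<in> path_image ?a"
    then obtain x where x: "-(pi/2) \<le> x" "x \<le> pi/2" "s = R * cis x"
      unfolding path_image_part_circlepath' by (auto simp: closed_segment_eq_real_ivl)
    then show "s \<in> {s. 0 \<le> Re s \<and> cmod s = R}"
      using R0 cos_ge_zero[of x] by (auto simp: norm_mult)
  qed
  have iml: "path_image ?l \<subseteq> {s. Re s = 0}"
    by (auto simp: closed_segment_same_Re)
  have im: "path_image (?a +++ ?l) \<subseteq> ?H - {z}"
    using ima iml z R by (subst path_image_join) (use ends in auto)
  have vp: "valid_path (?a +++ ?l)"
    using ends by (intro valid_path_join) auto
  have "(?F has_contour_integral (2*pi * \<i> * winding_number (?a +++ ?l) z * f z)) (?a +++ ?l)"
  proof (rule Cauchy_integral_formula_convex_simple[OF _ f _ vp im])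
    show "convex ?H" by (rule convex_halfspace_Re_ge)
    have "z \<in> {s. 0 < Re s}" "{s. 0 < Re s} \<subseteq> ?H" "open {s. 0 < Re s}"
      using z by (auto simp: open_halfspace_Re_gt)
    then show "z \<in> interior ?H" by (meson interiorI)
  qed (use ends in auto)
  then have I: "(?F has_contour_integral 0) (?a +++ ?l)" using f0 by simp
  have contF: "continuous_on (?H - {z}) ?F"
    by (intro continuous_intros continuous_on_subset[OF holomorphic_on_imp_continuous_on[OF f]]) auto
  have ia: "?F contour_integrable_on ?a"
    by (rule contour_integrable_continuous_part_circlepath, rule continuous_on_subset[OF contF])
      (use ima R in auto)
  have il: "?F contour_integrable_on ?l"
    by (rule contour_integrable_continuous_linepath, rule continuous_on_subset[OF contF])
      (use iml z in auto)
  have sum0: "contour_integral ?a ?F + contour_integral ?l ?F = 0"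
    using contour_integral_join[OF ia il] contour_integral_unique[OF I] ends by simp
  have ba: "cmod (contour_integral ?a ?F) \<le> B * R * \<bar>pi/2 - (-(pi/2))\<bar>"
  proof (rule contour_integral_bound_part_circlepath[OF ia])
    show "0 \<le> B" using B[of "of_real R"] R0 by (auto intro: order_trans[OF norm_ge_zero])
  qed (use R0 ima B in auto)
  have "contour_integral (linepath (- (\<i> * complex_of_real R)) (\<i> * complex_of_real R)) ?F
      = \<i> * integral {-R..R} (\<lambda>\<omega>. ?F (\<i> * complex_of_real \<omega>))"
    using contour_integral_linepath_same_Re[of "- (\<i> * complex_of_real R)" 0 "\<i> * complex_of_real R" "-R" R ?F] R0
    by (simp add: Complex_eq)
  moreover have "contour_integral ?l ?F = - contour_integral (linepath (- (\<i> * complex_of_real R)) (\<i> * complex_of_real R)) ?F"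
    by (rule contour_integral_reverse_linepath, rule continuous_on_subset[OF contF])
      (use z in \<open>auto simp: closed_segment_same_Re\<close>)
  ultimately have "cmod (contour_integral ?a ?F) = cmod (integral {-R..R} (\<lambda>\<omega>. ?F (\<i> * complex_of_real \<omega>)))"
    using sum0 by (simp add: add_eq_0_iff norm_mult)
  then show ?thesis using ba by simp
qed

text \<open>
  The reproducing property of the kernel \<open>1 / (s + cnj z)\<close>. On the imaginary axis, the conjugate of the kernel
  is \<open>- 1 / (s - z)\<close>, and the integrand \<open>f s / (s - z)\<close> decays quadratically, so the arcs contribute nothing in
  the limit.
\<close>

lemma axis_integral_eq_0:
  assumes f: "stable_proper f" and z: "0 < Re z" and f0: "f z = 0"
  shows "(\<integral>\<omega>. f (\<i> * complex_of_real \<omega>) * cnj (1 / (\<i> * complex_of_real \<omega> - (- cnj z))) \<partial>lborel) = 0"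
proof -
  let ?g = "\<lambda>\<omega>::real. f (\<i> * complex_of_real \<omega>) / (\<i> * complex_of_real \<omega> - z)"
  let ?k = "\<lambda>\<omega>::real. f (\<i> * complex_of_real \<omega>) * cnj (1 / (\<i> * complex_of_real \<omega> - (- cnj z)))"
  have kg: "?k \<omega> = - ?g \<omega>" for \<omega>
  proof -
    have "?k \<omega> = f (\<i> * complex_of_real \<omega>) / (z - \<i> * complex_of_real \<omega>)" by simp
    then show ?thesis by (metis minus_diff_eq minus_divide_right)
  qed
  have intk: "integrable lborel ?k"
    using z by (intro stable_proper_integrable_axis[OF f] stable_proper_simple_pole) auto
  then have "integrable lborel (\<lambda>\<omega>. - ?g \<omega>)" by (simp only: kg)
  then have intg: "integrable lborel ?g" using integrable_minus by fastforce
  obtain c where c0: "0 \<le> c" and c: "\<And>s. 0 \<le> Re s \<Longrightarrow> (1 + cmod s) * cmod (f s) \<le> c"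
    using stable_proper_bound[OF f] by metis
  have hol: "f holomorphic_on {s. 0 \<le> Re s}" using f unfolding stable_proper_def by blast
  have "((\<lambda>R. \<integral>\<omega>. indicator {-R..R} \<omega> *\<^sub>R ?g \<omega> \<partial>lborel) \<longlongrightarrow> (\<integral>\<omega>. ?g \<omega> \<partial>lborel)) at_top"
  proof (rule integral_dominated_convergence_at_top[where w = "\<lambda>\<omega>. norm (?g \<omega>)"])
    show "AE \<omega> in lborel. ((\<lambda>R. indicator {-R..R} \<omega> *\<^sub>R ?g \<omega>) \<longlongrightarrow> ?g \<omega>) at_top"
    proof (rule AE_I2)
      fix \<omega> :: real
      have "\<forall>\<^sub>F R in at_top. indicator {-R..R} \<omega> *\<^sub>R ?g \<omega> = ?g \<omega>"
        using eventually_ge_at_top[of "\<bar>\<omega>\<bar>"] by eventually_elim (auto simp: indicator_def)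
      then show "((\<lambda>R. indicator {-R..R} \<omega> *\<^sub>R ?g \<omega>) \<longlongrightarrow> ?g \<omega>) at_top"
        by (rule tendsto_eventually)
    qed
    show "\<forall>\<^sub>F R in at_top. AE \<omega> in lborel. norm (indicator {-R..R} \<omega> *\<^sub>R ?g \<omega>) \<le> norm (?g \<omega>)"
      by (intro always_eventually allI AE_I2) (simp add: indicator_def)
  qed (use intg in auto)
  moreover have "((\<lambda>R. \<integral>\<omega>. indicator {-R..R} \<omega> *\<^sub>R ?g \<omega> \<partial>lborel) \<longlongrightarrow> 0) at_top"
  proof (rule Lim_null_comparison)
    show "((\<lambda>R. c * pi / (R - cmod z)) \<longlongrightarrow> 0) at_top"
      by real_asymp
    show "\<forall>\<^sub>F R in at_top. norm (\<integral>\<omega>. indicator {-R..R} \<omega> *\<^sub>R ?g \<omega> \<partial>lborel) \<le> c * pi / (R - cmod z)"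
      using eventually_gt_at_top[of "cmod z"]
    proof eventually_elim
      case (elim R)
      have R0: "0 < R" using elim norm_ge_zero le_less_trans by blast
      have "set_integrable lborel {-R..R} ?g"
        unfolding set_integrable_def using intg by (intro integrable_mult_indicator) auto
      then have "(\<integral>\<omega>. indicator {-R..R} \<omega> *\<^sub>R ?g \<omega> \<partial>lborel) = integral {-R..R} ?g"
        using set_borel_integral_eq_integral(2) unfolding set_lebesgue_integral_def by blast
      moreover have "cmod (integral {-R..R} ?g) \<le> c / (R * (R - cmod z)) * R * pi"
      proof (rule half_disc_integral_bound[OF hol z f0 elim])
        fix s assume s: "0 \<le> Re s" "cmod s = R"
        have "R * cmod (f s) \<le> (1 + R) * cmod (f s)" by (intro mult_right_mono) auto
        then have "R * cmod (f s) \<le> c" using c[OF s(1)] s(2) by simp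
        then have fs: "cmod (f s) \<le> c / R" using R0 by (simp add: field_simps)
        have "R - cmod z \<le> cmod (s - z)" using norm_triangle_ineq2[of s z] s by simp
        then have "cmod (f s) / cmod (s - z) \<le> (c / R) / (R - cmod z)"
          using fs elim c0 R0 by (intro frac_le) auto
        then show "cmod (f s / (s - z)) \<le> c / (R * (R - cmod z))" by (simp add: norm_divide)
      qed
      ultimately show ?case using R0 by simp
    qed
  qed
  ultimately have "(\<integral>\<omega>. ?g \<omega> \<partial>lborel) = 0"
    using tendsto_unique trivial_limit_at_top_linorder by blast
  then show ?thesis by (simp only: kg) simp
qed

text \<open>
  Pythagoras: in the expansion of the square of \<open>f - g\<close> one mixed term vanishes by assumption, and the other is
  its conjugate. What remains besides the square of \<open>f\<close> is the nonnegative square of \<open>g\<close>.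
\<close>

lemma axis_norm_le_of_orthogonal:
  assumes f: "stable_proper f" and g: "stable_proper g"
    and orth: "(\<integral>\<omega>. f (\<i> * complex_of_real \<omega>) * cnj (g (\<i> * complex_of_real \<omega>)) \<partial>lborel) = 0"
  shows "Re (\<integral>\<omega>. f (\<i> * complex_of_real \<omega>) * cnj (f (\<i> * complex_of_real \<omega>)) \<partial>lborel)
    \<le> Re (\<integral>\<omega>. (f (\<i> * complex_of_real \<omega>) - g (\<i> * complex_of_real \<omega>))
        * cnj (f (\<i> * complex_of_real \<omega>) - g (\<i> * complex_of_real \<omega>)) \<partial>lborel)"
proof -
  let ?i = "\<lambda>u v. \<integral>\<omega>. u (\<i> * complex_of_real \<omega>) * cnj (v (\<i> * complex_of_real \<omega>)) \<partial>lborel"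
  note [simp] = stable_proper_integrable_axis[OF f f] stable_proper_integrable_axis[OF f g]
    stable_proper_integrable_axis[OF g f] stable_proper_integrable_axis[OF g g]
  have gf: "?i g f = 0"
  proof -
    have "?i g f = (\<integral>\<omega>. cnj (f (\<i> * complex_of_real \<omega>) * cnj (g (\<i> * complex_of_real \<omega>))) \<partial>lborel)"
      by (simp add: mult.commute)
    also have "\<dots> = cnj (?i f g)" by (rule Bochner_Integration.integral_cnj)
    finally show ?thesis using orth by simp
  qed
  have "(\<integral>\<omega>. (f (\<i> * complex_of_real \<omega>) - g (\<i> * complex_of_real \<omega>))
        * cnj (f (\<i> * complex_of_real \<omega>) - g (\<i> * complex_of_real \<omega>)) \<partial>lborel)
    = (\<integral>\<omega>. (f (\<i> * complex_of_real \<omega>) * cnj (f (\<i> * complex_of_real \<omega>))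
         - f (\<i> * complex_of_real \<omega>) * cnj (g (\<i> * complex_of_real \<omega>)))
         - (g (\<i> * complex_of_real \<omega>) * cnj (f (\<i> * complex_of_real \<omega>))
         - g (\<i> * complex_of_real \<omega>) * cnj (g (\<i> * complex_of_real \<omega>))) \<partial>lborel)"
    by (intro Bochner_Integration.integral_cong refl) (simp add: algebra_simps)
  also have "\<dots> = ?i f f - ?i f g - (?i g f - ?i g g)" by simp
  finally have eq: "(\<integral>\<omega>. (f (\<i> * complex_of_real \<omega>) - g (\<i> * complex_of_real \<omega>))
        * cnj (f (\<i> * complex_of_real \<omega>) - g (\<i> * complex_of_real \<omega>)) \<partial>lborel) = ?i f f + ?i g g"
    using orth gf by simp
  have "?i g g = (\<integral>\<omega>. complex_of_real ((cmod (g (\<i> * complex_of_real \<omega>)))\<^sup>2) \<partial>lborel)"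
    by (simp only: complex_norm_square)
  also have "\<dots> = complex_of_real (\<integral>\<omega>. (cmod (g (\<i> * complex_of_real \<omega>)))\<^sup>2 \<partial>lborel)"
    by (rule integral_complex_of_real)
  finally have "0 \<le> Re (?i g g)" by simp
  then show ?thesis unfolding eq by simp
qed

lemma axis_orthogonal_partial_fractions:
  assumes f: "stable_proper f" and re: "\<And>l. l < q \<Longrightarrow> 0 < Re (z l)" and f0: "\<And>l. l < q \<Longrightarrow> f (z l) = 0"
  shows "(\<integral>\<omega>. f (\<i> * complex_of_real \<omega>)
    * cnj (\<Sum>l<q. c l * (1 / (\<i> * complex_of_real \<omega> - (- cnj (z l))))) \<partial>lborel) = 0"
proof -
  let ?h = "\<lambda>l \<omega>. f (\<i> * complex_of_real \<omega>) * cnj (1 / (\<i> * complex_of_real \<omega> - (- cnj (z l))))"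
  have int: "integrable lborel (?h l)" if "l < q" for l
    using re[OF that] by (intro stable_proper_integrable_axis[OF f] stable_proper_simple_pole) simp
  have "(\<integral>\<omega>. f (\<i> * complex_of_real \<omega>)
      * cnj (\<Sum>l<q. c l * (1 / (\<i> * complex_of_real \<omega> - (- cnj (z l))))) \<partial>lborel)
    = (\<integral>\<omega>. (\<Sum>l<q. cnj (c l) * ?h l \<omega>) \<partial>lborel)"
    by (simp only: cnj_sum complex_cnj_mult sum_distrib_left mult.left_commute)
  also have "\<dots> = (\<Sum>l<q. cnj (c l) * (\<integral>\<omega>. ?h l \<omega> \<partial>lborel))"
  proof -
    have "(\<integral>\<omega>. (\<Sum>l<q. cnj (c l) * ?h l \<omega>) \<partial>lborel) = (\<Sum>l<q. \<integral>\<omega>. cnj (c l) * ?h l \<omega> \<partial>lborel)"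
      by (rule Bochner_Integration.integral_sum) (intro integrable_mult_right int, simp)
    then show ?thesis by (simp only: integral_mult_right_zero)
  qed
  also have "\<dots> = 0"
    using axis_integral_eq_0[OF f re f0] by (intro sum.neutral) auto
  finally show ?thesis .
qed

section \<open>Inverses and real matrices viewed as complex ones\<close>

lemma minv:
  fixes M :: "'a :: field mat"
  assumes M: "M \<in> carrier_mat n n" and det: "Determinant.det M \<noteq> 0"
  shows "minv M \<in> carrier_mat n n" "M * minv M = 1\<^sub>m n" "minv M * M = 1\<^sub>m n"
proof -
  have "M \<in> Units (ring_mat TYPE('a) n ())" using det_non_zero_imp_unit[OF M det] .
  then obtain N where "mat_inverse M = Some N" using mat_inverse(1)[OF M, where b = "()"] by (cases "mat_inverse M") auto
  from mat_inverse(2)[OF M this] this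
  show "minv M \<in> carrier_mat n n" "M * minv M = 1\<^sub>m n" "minv M * M = 1\<^sub>m n"
    unfolding minv_def by auto
qed

lemma minv_mult_eqI:
  fixes M :: "'a :: field mat"
  assumes M: "M \<in> carrier_mat n n" and det: "Determinant.det M \<noteq> 0"
    and X: "X \<in> carrier_mat n r" and MX: "M * X = Y"
  shows "minv M * Y = X"
  using minv[OF M det] M X unfolding MX[symmetric]
  by (simp add: assoc_mult_mat[of _ n n _ n _ r, symmetric])

lemma inverse_imp_det_nonzero:
  fixes M N :: "'a :: field mat"
  assumes "M \<in> carrier_mat n n" "N \<in> carrier_mat n n" "M * N = 1\<^sub>m n"
  shows "Determinant.det M \<noteq> 0"
  using det_mult[OF assms(1,2)] assms(3) by auto

lemma minv_eqI:
  fixes M N :: "'a :: field mat"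
  assumes M: "M \<in> carrier_mat n n" and N: "N \<in> carrier_mat n n" and MN: "M * N = 1\<^sub>m n"
  shows "minv M = N"
proof -
  have det: "Determinant.det M \<noteq> 0" by (rule inverse_imp_det_nonzero[OF M N MN])
  have "minv M * 1\<^sub>m n = N" by (rule minv_mult_eqI[OF M det N MN])
  then show ?thesis using minv(1)[OF M det] by simp
qed

lemma cmat_mult: "dim_col A = dim_row B \<Longrightarrow> cmat (A * B) = cmat A * cmat B"
  by (rule eq_matI) (auto simp: scalar_prod_def)

lemma cmat_add: "A \<in> carrier_mat r c \<Longrightarrow> B \<in> carrier_mat r c \<Longrightarrow> cmat (A + B) = cmat A + cmat B"
  by (rule eq_matI) auto

lemma cmat_one: "cmat (1\<^sub>m n) = 1\<^sub>m n"
  by (rule eq_matI) auto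

lemma cmat_det: "Determinant.det (cmat M) = complex_of_real (Determinant.det M)"
proof -
  have "comm_ring_hom complex_of_real" by unfold_locales auto
  from comm_ring_hom.hom_det[OF this] show ?thesis by simp
qed

lemma cmat_minv:
  assumes M: "M \<in> carrier_mat n n" and det: "Determinant.det M \<noteq> 0"
  shows "cmat (minv M) = minv (cmat M)"
proof -
  have "cmat M * cmat (minv M) = 1\<^sub>m n"
    using minv[OF M det] M cmat_mult[of M "minv M"] by (simp add: cmat_one)
  then show ?thesis using minv_eqI[of "cmat M" n "cmat (minv M)"] M minv(1)[OF M det] by simp
qed

lemma minv_uminus:
  fixes M :: "'a :: field mat"
  assumes M: "M \<in> carrier_mat n n" and det: "Determinant.det M \<noteq> 0"
  shows "minv (- M) = - minv M"
proof (rule minv_eqI)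
  show "- M * - minv M = 1\<^sub>m n"
    using minv[OF M det] M by simp
qed (use minv(1)[OF M det] M in auto)

lemma index_mult_mat_sum:
  assumes "M \<in> carrier_mat r n" "N \<in> carrier_mat n c" "i < r" "j < c"
  shows "(M * N) $$ (i, j) = (\<Sum>l<n. M $$ (i, l) * N $$ (l, j))"
  using assms by (simp add: scalar_prod_def atLeast0LessThan)

lemma assoc_mult_mat_inner:
  assumes A: "A \<in> carrier_mat n1 n2" and B: "B \<in> carrier_mat n2 n3"
    and C: "C \<in> carrier_mat n3 n4" and D: "D \<in> carrier_mat n4 n5"
  shows "A * (B * C) * D = A * B * (C * D)"
  unfolding assoc_mult_mat[OF A B C, symmetric] by (rule assoc_mult_mat[OF mult_carrier_mat[OF A B] C D])

lemma similar_diag_eigenvalue: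
  fixes M :: "complex mat"
  assumes M: "M \<in> carrier_mat q q" and sim: "similar_mat M (mat_diag q d)" and ev: "eigenvalue M \<mu>"
  shows "\<exists>l<q. \<mu> = d l"
proof -
  have ut: "upper_triangular (mat_diag q d)" by (auto simp: mat_diag_def)
  have "char_poly M = (\<Prod>a\<leftarrow>diag_mat (mat_diag q d). [:- a, 1:])"
    using char_poly_similar[OF sim] char_poly_upper_triangular[OF mat_diag_dim ut] by simp
  moreover have "poly (char_poly M) \<mu> = 0" using ev eigenvalue_root_char_poly[OF M] by simp
  ultimately have "\<mu> \<in> set (diag_mat (mat_diag q d))"
    by (auto simp: poly_prod_list prod_list_zero_iff)
  then show ?thesis by (auto simp: diag_mat_def mat_diag_def)
qed

text \<open>
  The pencil form \<open>A Q = E Q D\<close> comes out of the Lyapunov equation, whereas the competing systems are compared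
  through \<open>E\<^sup>-\<^sup>1 A\<close>.
\<close>

lemma similar_of_pencil_diagonalization:
  fixes A E Q D :: "complex mat"
  assumes A: "A \<in> carrier_mat q q" and E: "E \<in> carrier_mat q q" and Q: "Q \<in> carrier_mat q q"
    and D: "D \<in> carrier_mat q q" and detE: "Determinant.det E \<noteq> 0" and detQ: "Determinant.det Q \<noteq> 0"
    and eq: "A * Q = E * Q * D"
  shows "similar_mat (minv E * A) D"
proof -
  note iE = minv[OF E detE] and iQ = minv[OF Q detQ]
  have J: "minv E * A \<in> carrier_mat q q" using iE A by auto
  have "minv E * A * Q = minv E * (E * Q * D)"
    unfolding assoc_mult_mat[OF iE(1) A Q] eq ..
  also have "\<dots> = (minv E * E) * (Q * D)"
    unfolding assoc_mult_mat[OF E Q D] by (rule assoc_mult_mat[OF iE(1) E mult_carrier_mat[OF Q D], symmetric])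
  also have "\<dots> = Q * D" unfolding iE(3) by (rule left_mult_one_mat[OF mult_carrier_mat[OF Q D]])
  finally have "minv E * A * Q * minv Q = Q * D * minv Q" by simp
  then have "minv E * A = Q * D * minv Q"
    unfolding assoc_mult_mat[OF J Q iQ(1)] iQ(2) right_mult_one_mat[OF J] .
  then show ?thesis
    unfolding similar_mat_def using similar_mat_witI[OF iQ(2,3) _ J D Q iQ(1)] by blast
qed

section \<open>Transfer functions of stable systems\<close>

text \<open>
  A kernel vector of the pencil at \<open>s\<close> would be an eigenvector of \<open>E\<^sup>-\<^sup>1 A\<close> for the eigenvalue \<open>s\<close>.
\<close>

lemma stable_pencil_det:
  assumes A: "A \<in> carrier_mat n n" and E: "E \<in> carrier_mat n n" and det: "Determinant.det E \<noteq> 0"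
    and st: "asymp_stable A E" and s: "0 \<le> Re s"
  shows "Determinant.det (s \<cdot>\<^sub>m cmat E - cmat A) \<noteq> 0"
proof
  let ?M = "s \<cdot>\<^sub>m cmat E - cmat A"
  have cA: "cmat A \<in> carrier_mat n n" and cE: "cmat E \<in> carrier_mat n n" using A E by auto
  then have M: "?M \<in> carrier_mat n n" by auto
  assume "Determinant.det ?M = 0"
  then obtain v where v: "v \<in> carrier_vec n" "v \<noteq> 0\<^sub>v n" "?M *\<^sub>v v = 0\<^sub>v n"
    using det_0_iff_vec_prod_zero_field[OF M] by auto
  have detc: "Determinant.det (cmat E) \<noteq> 0" using det by (simp add: cmat_det)
  note iE = minv[OF cE detc]
  have "s \<cdot>\<^sub>v (cmat E *\<^sub>v v) - cmat A *\<^sub>v v = 0\<^sub>v n"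
  proof -
    have "(s \<cdot>\<^sub>m cmat E) *\<^sub>v v = s \<cdot>\<^sub>v (cmat E *\<^sub>v v)"
      using E v(1) by (intro eq_vecI) (auto simp: scalar_prod_def sum_distrib_left algebra_simps)
    then show ?thesis
      using v(3) minus_mult_distrib_mat_vec[of "s \<cdot>\<^sub>m cmat E" n n "cmat A" v] v(1) cA cE by simp
  qed
  then have Av: "cmat A *\<^sub>v v = s \<cdot>\<^sub>v (cmat E *\<^sub>v v)"
    using cA cE v(1) by (intro eq_vecI) (auto simp: vec_eq_iff)
  have "cmat (minv E * A) *\<^sub>v v = minv (cmat E) *\<^sub>v (cmat A *\<^sub>v v)"
    using A E det v(1) iE cA minv(1)[OF E det]
    by (simp add: cmat_mult cmat_minv assoc_mult_mat_vec[of _ n n _ n])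
  also have "\<dots> = s \<cdot>\<^sub>v (minv (cmat E) *\<^sub>v (cmat E *\<^sub>v v))"
    unfolding Av using iE cE v(1) by (simp add: mult_mat_vec[of _ n n])
  also have "\<dots> = s \<cdot>\<^sub>v v"
    using iE cE v(1) by (simp add: assoc_mult_mat_vec[of _ n n _ n, symmetric])
  finally have "eigenvalue (cmat (minv E * A)) s"
    using v A E minv(1)[OF E det] unfolding eigenvalue_def eigenvector_def by auto
  then show False using st s unfolding asymp_stable_def by force
qed

lemma pencil_det_shifted:
  assumes A: "A \<in> carrier_mat n n" and E: "E \<in> carrier_mat n n" and det: "Determinant.det E \<noteq> 0"
    and st: "asymp_stable A E" and s: "0 \<le> Re s"
  shows "Determinant.det (cmat A - s \<cdot>\<^sub>m cmat E) \<noteq> 0"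
proof -
  have M: "s \<cdot>\<^sub>m cmat E - cmat A \<in> carrier_mat n n" using A E by auto
  have "cmat A - s \<cdot>\<^sub>m cmat E = - (s \<cdot>\<^sub>m cmat E - cmat A)" using A E by (intro eq_matI) auto
  then show ?thesis using stable_pencil_det[OF A E det st s] det_0_negate[OF M] by simp
qed

text \<open>
  The entrywise \<open>\<ell>\<^sub>1\<close> norm. It is submultiplicative, which is what the resolvent estimate needs.
\<close>

definition norm1 :: "complex mat \<Rightarrow> real" where
  "norm1 M = (\<Sum>i<dim_row M. \<Sum>j<dim_col M. cmod (M $$ (i, j)))"

lemma norm1_nonneg: "0 \<le> norm1 M"
  unfolding norm1_def by (intro sum_nonneg) auto

lemma norm_entry_le_norm1:
  assumes "i < dim_row M" "j < dim_col M"
  shows "cmod (M $$ (i, j)) \<le> norm1 M"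
proof -
  have "cmod (M $$ (i, j)) \<le> (\<Sum>j<dim_col M. cmod (M $$ (i, j)))"
    using assms(2) by (intro member_le_sum[of j "{..<dim_col M}" "\<lambda>j. cmod (M $$ (i, j))"]) auto
  also have "\<dots> \<le> norm1 M" unfolding norm1_def
    using assms(1) by (intro member_le_sum[of i "{..<dim_row M}" "\<lambda>i. \<Sum>j<dim_col M. cmod (M $$ (i, j))"]) (auto intro: sum_nonneg)
  finally show ?thesis .
qed

lemma norm1_add:
  assumes "M \<in> carrier_mat r c" "N \<in> carrier_mat r c"
  shows "norm1 (M + N) \<le> norm1 M + norm1 N"
proof -
  have "norm1 (M + N) = (\<Sum>i<r. \<Sum>j<c. cmod (M $$ (i, j) + N $$ (i, j)))"
    unfolding norm1_def using assms by simp
  also have "\<dots> \<le> (\<Sum>i<r. \<Sum>j<c. cmod (M $$ (i, j)) + cmod (N $$ (i, j)))"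
    by (intro sum_mono norm_triangle_ineq)
  then show ?thesis using assms by (simp add: norm1_def sum.distrib)
qed

lemma norm1_mult:
  assumes M: "M \<in> carrier_mat r n" and N: "N \<in> carrier_mat n c"
  shows "norm1 (M * N) \<le> norm1 M * norm1 N"
proof -
  have "norm1 (M * N) = (\<Sum>i<r. \<Sum>j<c. cmod (\<Sum>l<n. M $$ (i, l) * N $$ (l, j)))"
    using M N by (simp add: norm1_def scalar_prod_def atLeast0LessThan)
  also have "\<dots> \<le> (\<Sum>i<r. \<Sum>j<c. \<Sum>l<n. cmod (M $$ (i, l)) * cmod (N $$ (l, j)))"
    by (intro sum_mono order_trans[OF norm_sum]) (simp add: norm_mult)
  also have "\<dots> = (\<Sum>i<r. \<Sum>l<n. cmod (M $$ (i, l)) * (\<Sum>j<c. cmod (N $$ (l, j))))"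
    by (subst sum.swap) (simp add: sum_distrib_left)
  also have "\<dots> \<le> (\<Sum>i<r. \<Sum>l<n. cmod (M $$ (i, l)) * norm1 N)"
  proof (intro sum_mono mult_left_mono)
    fix l assume "l \<in> {..<n}"
    then show "(\<Sum>j<c. cmod (N $$ (l, j))) \<le> norm1 N" unfolding norm1_def
      using N member_le_sum[of l "{..<n}" "\<lambda>i. \<Sum>j<c. cmod (N $$ (i, j))"] by (simp add: sum_nonneg)
  qed auto
  also have "\<dots> = norm1 M * norm1 N"
    using M by (simp add: norm1_def sum_distrib_right)
  finally show ?thesis .
qed

lemma holomorphic_on_det:
  assumes "\<And>s. M s \<in> carrier_mat n n"
    and "\<And>i j. i < n \<Longrightarrow> j < n \<Longrightarrow> (\<lambda>s. M s $$ (i, j)) holomorphic_on S"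
  shows "(\<lambda>s. Determinant.det (M s)) holomorphic_on S"
proof -
  have "(\<lambda>s. Determinant.det (M s)) =
      (\<lambda>s. \<Sum>p\<in>{p. p permutes {0..<n}}. signof p * (\<Prod>i = 0..<n. M s $$ (i, p i)))"
    using det_def'[OF assms(1)] by simp
  moreover have "(\<lambda>s. M s $$ (i, p i)) holomorphic_on S" if "p permutes {0..<n}" "i < n" for p i
    using assms(2)[of i "p i"] that permutes_in_image[OF that(1), of i] by auto
  ultimately show ?thesis by (auto intro!: holomorphic_intros)
qed

lemma mat_eq_diffD:
  fixes X Y Z :: "'a :: ab_group_add mat"
  assumes "Y = X - Z" "X \<in> carrier_mat r c" "Z \<in> carrier_mat r c"
  shows "X = Y + Z"
  unfolding assms(1) using assms(2,3) by (intro eq_matI) auto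

text \<open>
  Holomorphy comes from the adjugate formula. For the decay, put \<open>R s = (s E - A)\<^sup>-\<^sup>1\<close>. Then
  \<open>s R s = E\<^sup>-\<^sup>1 + R s (A E\<^sup>-\<^sup>1)\<close>, so \<open>s R s\<close> stays bounded as soon as \<open>s\<close> exceeds twice the norm of
  \<open>A E\<^sup>-\<^sup>1\<close>.
\<close>

lemma stable_proper_resolvent_entry:
  assumes A: "A \<in> carrier_mat n n" and E: "E \<in> carrier_mat n n" and det: "Determinant.det E \<noteq> 0"
    and st: "asymp_stable A E" and i: "i < n" and j: "j < n"
  shows "stable_proper (\<lambda>s. minv (s \<cdot>\<^sub>m cmat E - cmat A) $$ (i, j))"
proof -
  let ?M = "\<lambda>s. s \<cdot>\<^sub>m cmat E - cmat A" and ?H = "{s. 0 \<le> Re s}"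
  have cA: "cmat A \<in> carrier_mat n n" and cE: "cmat E \<in> carrier_mat n n" using A E by auto
  then have M: "?M s \<in> carrier_mat n n" for s by auto
  have d: "Determinant.det (?M s) \<noteq> 0" if "0 \<le> Re s" for s
    by (rule stable_pencil_det[OF A E det st that])
  note iM = minv[OF M d]
  have detc: "Determinant.det (cmat E) \<noteq> 0" using det by (simp add: cmat_det)
  note iE = minv[OF cE detc]
  have eq: "minv (?M s) $$ (i, j) = adj_mat (?M s) $$ (i, j) / Determinant.det (?M s)" if s: "0 \<le> Re s" for s
  proof -
    have "?M s * (inverse (Determinant.det (?M s)) \<cdot>\<^sub>m adj_mat (?M s)) = 1\<^sub>m n"
      using adj_mat[OF M[of s]] M[of s] d[OF s] by (auto simp: mult_smult_distrib[of _ n n _ n] intro!: eq_matI)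
    then have "minv (?M s) = inverse (Determinant.det (?M s)) \<cdot>\<^sub>m adj_mat (?M s)"
      using minv_eqI[OF M] adj_mat(1)[OF M] by (metis smult_carrier_mat)
    then show ?thesis using i j adj_mat(1)[OF M[of s]] by (simp add: field_simps)
  qed
  have hM: "(\<lambda>s. ?M s $$ (i', j')) holomorphic_on ?H" if "i' < n" "j' < n" for i' j'
    using A E that by (auto intro!: holomorphic_intros)
  have "(\<lambda>s. Determinant.det (mat_delete (?M s) j i)) holomorphic_on ?H"
  proof (rule holomorphic_on_det)
    show "mat_delete (?M s) j i \<in> carrier_mat (n - 1) (n - 1)" for s
      using mat_delete_carrier[OF M[of s]] .
    fix i' j' assume ij: "i' < n - 1" "j' < n - 1"
    have "mat_delete (?M s) j i $$ (i', j')
        = ?M s $$ (if i' < j then i' else Suc i', if j' < i then j' else Suc j')" for s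
      using ij i j A E unfolding mat_delete_def by (simp split: if_splits)
    then show "(\<lambda>s. mat_delete (?M s) j i $$ (i', j')) holomorphic_on ?H"
      using ij by (simp only:) (intro hM, auto)
  qed
  then have "(\<lambda>s. adj_mat (?M s) $$ (i, j)) holomorphic_on ?H"
    using i j A unfolding adj_mat_def cofactor_def by (auto intro!: holomorphic_intros)
  then have "(\<lambda>s. adj_mat (?M s) $$ (i, j) / Determinant.det (?M s)) holomorphic_on ?H"
    using d M hM by (intro holomorphic_on_divide holomorphic_on_det) auto
  then have hol: "(\<lambda>s. minv (?M s) $$ (i, j)) holomorphic_on ?H"
    by (rule holomorphic_transform) (simp add: eq)
  let ?K = "cmat A * minv (cmat E)"
  have "cmod s * cmod (minv (?M s) $$ (i, j)) \<le> 2 * norm1 (minv (cmat E))"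
    if s: "0 \<le> Re s" and large: "2 * norm1 ?K + 1 \<le> cmod s" for s
  proof -
    let ?R = "minv (?M s)"
    note R = iM[OF s]
    have "s \<cdot>\<^sub>m ?R = minv (cmat E) + ?R * ?K"
    proof -
      have "(?R * ?M s) * minv (cmat E) = s \<cdot>\<^sub>m ?R - ?R * ?K"
      proof -
        have "(?R * ?M s) * minv (cmat E) = ?R * (s \<cdot>\<^sub>m (cmat E * minv (cmat E)) - ?K)"
          using R(1) M[of s] cA cE iE(1)
          by (simp add: assoc_mult_mat[of _ n n _ n _ n] minus_mult_distrib_mat[of _ n n _ _ n] mult_smult_assoc_mat[of _ n n _ n])
        also have "\<dots> = s \<cdot>\<^sub>m ?R - ?R * ?K"
          using R(1) cA iE by (simp add: mult_minus_distrib_mat[of _ n n _ n] mult_smult_distrib[of _ n n _ n])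
        finally show ?thesis .
      qed
      then have "minv (cmat E) = s \<cdot>\<^sub>m ?R - ?R * ?K" using R iE by simp
      then show ?thesis using R(1) cA iE(1) by (intro mat_eq_diffD) auto
    qed
    then have "norm1 (s \<cdot>\<^sub>m ?R) \<le> norm1 (minv (cmat E)) + norm1 (?R * ?K)"
      using norm1_add[of "minv (cmat E)" n n "?R * ?K"] R(1) cA iE(1) by auto
    moreover have "norm1 (s \<cdot>\<^sub>m ?R) = cmod s * norm1 ?R"
      by (simp add: norm1_def norm_mult sum_distrib_left)
    moreover have "norm1 (?R * ?K) \<le> norm1 ?R * norm1 ?K"
      using R(1) cA iE(1) by (intro norm1_mult[of _ n n _ n]) auto
    moreover have "norm1 ?R * (2 * norm1 ?K) \<le> norm1 ?R * cmod s"
      using large norm1_nonneg by (intro mult_left_mono) auto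
    ultimately have "cmod s * norm1 ?R \<le> 2 * norm1 (minv (cmat E))" by (simp add: algebra_simps)
    moreover have "cmod s * cmod (?R $$ (i, j)) \<le> cmod s * norm1 ?R"
      using R(1) i j by (intro mult_left_mono norm_entry_le_norm1) auto
    ultimately show ?thesis by linarith
  qed
  then show ?thesis using hol unfolding stable_proper_def by blast
qed

lemma stable_proper_transfer_fun:
  assumes A: "A \<in> carrier_mat n n" and E: "E \<in> carrier_mat n n" and det: "Determinant.det E \<noteq> 0"
    and st: "asymp_stable A E" and B: "B \<in> carrier_mat n m" and C: "C \<in> carrier_mat p n"
    and a: "a < p" and b: "b < m"
  shows "stable_proper (\<lambda>s. transfer_fun A E B C s $$ (a, b))"
proof -
  let ?R = "\<lambda>s. minv (s \<cdot>\<^sub>m cmat E - cmat A)"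
  let ?f = "\<lambda>s. \<Sum>i<n. cmat C $$ (a, i) * (\<Sum>j<n. cmat B $$ (j, b) * ?R s $$ (i, j))"
  have cA: "cmat A \<in> carrier_mat n n" and cE: "cmat E \<in> carrier_mat n n" using A E by auto
  have f: "stable_proper ?f"
    by (intro stable_proper_sum stable_proper_cmult stable_proper_resolvent_entry[OF A E det st]) auto
  have eq: "transfer_fun A E B C s $$ (a, b) = ?f s" if "0 \<le> Re s" for s
  proof -
    have "s \<cdot>\<^sub>m cmat E - cmat A \<in> carrier_mat n n" using cA cE by auto
    from minv(1)[OF this stable_pencil_det[OF A E det st that]]
    have R: "?R s \<in> carrier_mat n n" .
    show ?thesis using R B C a b unfolding transfer_fun_def
      by (auto simp: scalar_prod_def atLeast0LessThan mult.commute intro!: sum.cong)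
  qed
  show ?thesis using f unfolding stable_proper_def
    by (auto simp: eq intro: holomorphic_transform)
qed

lemma carrier_transfer_fun: "transfer_fun A E B C s \<in> carrier_mat (dim_row C) (dim_col B)"
  unfolding transfer_fun_def by (rule carrier_matI) simp_all

lemma h2_norm_entrywise:
  assumes F: "\<And>\<omega>. F (\<i> * complex_of_real \<omega>) \<in> carrier_mat p m"
    and int: "\<And>a b. a < p \<Longrightarrow> b < m \<Longrightarrow> integrable lborel
      (\<lambda>\<omega>. F (\<i> * complex_of_real \<omega>) $$ (a, b) * cnj (F (\<i> * complex_of_real \<omega>) $$ (a, b)))"
  shows "h2_norm F = sqrt (1 / (2 * pi) * (\<Sum>a<p. \<Sum>b<m. Re (\<integral>\<omega>.
    F (\<i> * complex_of_real \<omega>) $$ (a, b) * cnj (F (\<i> * complex_of_real \<omega>) $$ (a, b)) \<partial>lborel)))"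
proof -
  have tr: "mat_trace (map_mat cnj M * transpose_mat M) = (\<Sum>a<p. \<Sum>b<m. M $$ (a, b) * cnj (M $$ (a, b)))"
    if "M \<in> carrier_mat p m" for M
    using that by (simp add: mat_trace_def scalar_prod_def atLeast0LessThan mult.commute)
  let ?f = "\<lambda>a b \<omega>. F (\<i> * complex_of_real \<omega>) $$ (a, b) * cnj (F (\<i> * complex_of_real \<omega>) $$ (a, b))"
  have "(\<integral>\<omega>. (\<Sum>a<p. \<Sum>b<m. ?f a b \<omega>) \<partial>lborel) = (\<Sum>a<p. \<integral>\<omega>. (\<Sum>b<m. ?f a b \<omega>) \<partial>lborel)"
    by (rule Bochner_Integration.integral_sum) (auto intro!: Bochner_Integration.integrable_sum int)
  also have "\<dots> = (\<Sum>a<p. \<Sum>b<m. \<integral>\<omega>. ?f a b \<omega> \<partial>lborel)"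
    by (intro sum.cong refl Bochner_Integration.integral_sum) (auto intro!: int)
  finally show ?thesis
    unfolding h2_norm_def tr[OF F] by (simp only: Re_sum)
qed

text \<open>
  If \<open>E\<^sup>-\<^sup>1 A = P D Q\<close> with \<open>D\<close> diagonal and \<open>Q = P\<^sup>-\<^sup>1\<close>, then the resolvent of the pencil is
  \<open>P (s - D)\<^sup>-\<^sup>1 Q E\<^sup>-\<^sup>1\<close>. The residues \<open>\<rho>\<close> are complex although the system is real.
\<close>

lemma transfer_fun_partial_fractions:
  assumes A: "A \<in> carrier_mat q q" and E: "E \<in> carrier_mat q q" and det: "Determinant.det E \<noteq> 0"
    and B: "B \<in> carrier_mat q m" and C: "C \<in> carrier_mat p q"
    and sim: "similar_mat (cmat (minv E * A)) (mat_diag q d)"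
  obtains \<rho> where "\<forall>a<p. \<forall>b<m. \<forall>s. (\<forall>l<q. s \<noteq> d l) \<longrightarrow>
    transfer_fun A E B C s $$ (a, b) = (\<Sum>l<q. \<rho> a b l * (1 / (s - d l)))"
proof -
  have cA: "cmat A \<in> carrier_mat q q" and cE: "cmat E \<in> carrier_mat q q"
    and cB: "cmat B \<in> carrier_mat q m" and cC: "cmat C \<in> carrier_mat p q" using A E B C by auto
  have detc: "Determinant.det (cmat E) \<noteq> 0" using det by (simp add: cmat_det)
  note iE = minv[OF cE detc]
  have J: "cmat (minv E * A) = minv (cmat E) * cmat A"
    using minv(1)[OF E det] A by (simp add: cmat_mult cmat_minv[OF E det])
  have Jc: "minv (cmat E) * cmat A \<in> carrier_mat q q" using iE(1) cA by auto
  obtain P Q where PQ: "P \<in> carrier_mat q q" "Q \<in> carrier_mat q q" "P * Q = 1\<^sub>m q" "Q * P = 1\<^sub>m q"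
    and Jeq: "minv (cmat E) * cmat A = P * mat_diag q d * Q"
    using sim similar_mat_witD2[OF Jc] unfolding J similar_mat_def by metis
  have EP: "cmat E * P \<in> carrier_mat q q" and QE: "Q * minv (cmat E) \<in> carrier_mat q q"
    using cE PQ iE by auto
  have Aeq: "cmat A = cmat E * P * mat_diag q d * Q"
  proof -
    have "cmat A = cmat E * (minv (cmat E) * cmat A)" using assoc_mult_mat[OF cE iE(1) cA] iE(2) cA by simp
    also have "\<dots> = cmat E * P * mat_diag q d * Q"
      unfolding Jeq using assoc_mult_mat[OF cE mult_carrier_mat[OF PQ(1) mat_diag_dim] PQ(2), of d]
        assoc_mult_mat[OF cE PQ(1) mat_diag_dim, of d] by simp
    finally show ?thesis .
  qed
  define \<rho> where "\<rho> a b l = (cmat C * P) $$ (a, l) * (Q * minv (cmat E) * cmat B) $$ (l, b)" for a b l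
  have "transfer_fun A E B C s $$ (a, b) = (\<Sum>l<q. \<rho> a b l * (1 / (s - d l)))"
    if a: "a < p" and b: "b < m" and s: "\<forall>l<q. s \<noteq> d l" for a b s
  proof -
    let ?D = "mat_diag q (\<lambda>l. s - d l)" and ?I = "mat_diag q (\<lambda>l. 1 / (s - d l))"
    have D: "?D \<in> carrier_mat q q" and I: "?I \<in> carrier_mat q q" by auto
    have DI: "?D * ?I = 1\<^sub>m q" unfolding mat_diag_diag using s by (intro eq_matI) (auto simp: mat_diag_def)
    have "s \<cdot>\<^sub>m cmat E = cmat E * P * mat_diag q (\<lambda>_. s) * Q"
    proof -
      have "cmat E * P * mat_diag q (\<lambda>_. s) = s \<cdot>\<^sub>m (cmat E * P)"
        unfolding mat_diag_mult_right[OF EP] using EP E PQ by (intro eq_matI) (auto simp: mult.commute simp del: index_mult_mat(1))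
      then have "cmat E * P * mat_diag q (\<lambda>_. s) * Q = s \<cdot>\<^sub>m (cmat E * P * Q)"
        using mult_smult_assoc_mat[OF EP PQ(2)] by simp
      also have "cmat E * P * Q = cmat E" using assoc_mult_mat[OF cE PQ(1,2)] PQ(3) cE by simp
      finally show ?thesis by simp
    qed
    then have "s \<cdot>\<^sub>m cmat E - cmat A = cmat E * P * mat_diag q (\<lambda>_. s) * Q - cmat E * P * mat_diag q d * Q"
      using Aeq by simp
    also have "\<dots> = (cmat E * P * mat_diag q (\<lambda>_. s) - cmat E * P * mat_diag q d) * Q"
      by (rule minus_mult_distrib_mat[symmetric, OF mult_carrier_mat[OF EP mat_diag_dim] mult_carrier_mat[OF EP mat_diag_dim] PQ(2)])
    also have "cmat E * P * mat_diag q (\<lambda>_. s) - cmat E * P * mat_diag q d = cmat E * P * ?D"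
      unfolding mat_diag_mult_right[OF EP] by (intro eq_matI) (auto simp: algebra_simps)
    finally have Meq: "s \<cdot>\<^sub>m cmat E - cmat A = cmat E * P * ?D * Q" .
    have QI: "P * ?I \<in> carrier_mat q q" and EPD: "cmat E * P * ?D \<in> carrier_mat q q" using PQ EP by auto
    have "(cmat E * P * ?D * Q) * (P * ?I * (Q * minv (cmat E))) = cmat E * P * ?D * (Q * P) * (?I * (Q * minv (cmat E)))"
      using assoc_mult_mat_inner[OF EPD PQ(2,1) mult_carrier_mat[OF I QE]] assoc_mult_mat[OF PQ(1) I QE] by simp
    also have "\<dots> = cmat E * P * (?D * ?I) * (Q * minv (cmat E))"
      unfolding PQ(4) right_mult_one_mat[OF EPD] assoc_mult_mat_inner[OF EP D I QE] ..
    also have "\<dots> = cmat E * (P * Q) * minv (cmat E)"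
      unfolding DI right_mult_one_mat[OF EP] assoc_mult_mat_inner[OF cE PQ(1,2) iE(1)] ..
    also have "\<dots> = 1\<^sub>m q" unfolding PQ(3) right_mult_one_mat[OF cE] by (rule iE(2))
    finally have inv: "minv (s \<cdot>\<^sub>m cmat E - cmat A) = P * ?I * (Q * minv (cmat E))"
      unfolding Meq by (rule minv_eqI[OF mult_carrier_mat[OF EPD PQ(2)] mult_carrier_mat[OF QI QE]])
    have CP: "cmat C * P \<in> carrier_mat p q" and QEB: "Q * minv (cmat E) * cmat B \<in> carrier_mat q m"
      using cC PQ QE cB by auto
    have "transfer_fun A E B C s = cmat C * P * ?I * (Q * minv (cmat E) * cmat B)"
      unfolding transfer_fun_def inv assoc_mult_mat[OF cC mult_carrier_mat[OF QI QE] cB]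
        assoc_mult_mat[OF QI QE cB] assoc_mult_mat[OF PQ(1) I QEB] assoc_mult_mat[OF cC PQ(1) mult_carrier_mat[OF I QEB], symmetric]
        assoc_mult_mat[OF CP I QEB] ..
    also have "\<dots> $$ (a, b) = (\<Sum>l<q. (cmat C * P * ?I) $$ (a, l) * (Q * minv (cmat E) * cmat B) $$ (l, b))"
      by (rule index_mult_mat_sum[OF mult_carrier_mat[OF CP I] QEB a b])
    also have "\<dots> = (\<Sum>l<q. \<rho> a b l * (1 / (s - d l)))"
      unfolding \<rho>_def mat_diag_mult_right[OF CP] using a by (intro sum.cong refl) (simp del: index_mult_mat(1))
    finally show ?thesis .
  qed
  then show thesis using that by blast
qed

section \<open>Conjugate transposes and the Lyapunov equation\<close>

lemma dim_mat_adjoint [simp]: "dim_row (mat_adjoint M) = dim_col M" "dim_col (mat_adjoint M) = dim_row M"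
  by (simp_all add: mat_adjoint_def)

lemma mat_adjoint_index [simp]:
  fixes M :: "complex mat"
  assumes "i < dim_col M" "j < dim_row M"
  shows "mat_adjoint M $$ (i, j) = cnj (M $$ (j, i))"
  using assms unfolding mat_adjoint_def by (simp add: mat_of_rows_index)

lemma mat_adjoint_carrier [simp]: "M \<in> carrier_mat r c \<Longrightarrow> mat_adjoint M \<in> carrier_mat c r"
  by auto

lemma mat_adjoint_mult:
  fixes M N :: "complex mat"
  assumes "M \<in> carrier_mat r n" "N \<in> carrier_mat n c"
  shows "mat_adjoint (M * N) = mat_adjoint N * mat_adjoint M"
  using assms by (intro eq_matI) (auto simp: scalar_prod_def mult.commute)

lemma mat_adjoint_add:
  fixes M N :: "complex mat"
  assumes "M \<in> carrier_mat r c" "N \<in> carrier_mat r c"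
  shows "mat_adjoint (M + N) = mat_adjoint M + mat_adjoint N"
  using assms by (intro eq_matI) auto

lemma mat_adjoint_adjoint [simp]:
  fixes M :: "complex mat"
  shows "mat_adjoint (mat_adjoint M) = M"
  by (intro eq_matI) auto

lemma mat_adjoint_one: "mat_adjoint (1\<^sub>m n :: complex mat) = 1\<^sub>m n"
  by (intro eq_matI) auto

lemma mat_adjoint_cmat: "mat_adjoint (cmat M) = cmat (transpose_mat M)"
  by (intro eq_matI) auto

text \<open>
  The diagonal entries of \<open>M M\<^sup>*\<close> are the squared norms of the rows of \<open>M\<close>.
\<close>

lemma mult_adjoint_eq_0D:
  fixes M :: "complex mat"
  assumes M: "M \<in> carrier_mat r c" and eq: "M * mat_adjoint M = 0\<^sub>m r r"
  shows "M = 0\<^sub>m r c"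
proof (rule eq_matI)
  fix i j assume "i < dim_row (0\<^sub>m r c :: complex mat)" "j < dim_col (0\<^sub>m r c :: complex mat)"
  then have i: "i < r" and j: "j < c" by auto
  have "(M * mat_adjoint M) $$ (i, i) = complex_of_real (\<Sum>j<c. (cmod (M $$ (i, j)))\<^sup>2)"
    using M i by (simp add: scalar_prod_def atLeast0LessThan complex_norm_square del: of_real_power)
  then have "(\<Sum>j<c. (cmod (M $$ (i, j)))\<^sup>2) = 0"
    unfolding eq using i by (metis index_zero_mat(1) of_real_eq_0_iff)
  then have "(cmod (M $$ (i, j)))\<^sup>2 = 0" using j by (subst (asm) sum_nonneg_eq_0_iff) auto
  then show "M $$ (i, j) = 0\<^sub>m r c $$ (i, j)" using i j by simp
qed (use M in auto)

lemma mat_add_rearrange: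
  fixes M1 M2 M3 M4 M5 :: "'a :: comm_monoid_add mat"
  assumes "M1 \<in> carrier_mat r c" "M2 \<in> carrier_mat r c" "M3 \<in> carrier_mat r c"
    "M4 \<in> carrier_mat r c" "M5 \<in> carrier_mat r c"
  shows "M1 + M2 + (M3 + (M4 + M5)) = M4 + M2 + (M5 + M3) + M1"
  using assms by (intro eq_matI) (auto simp: ac_simps)

lemma mat_add_eq_0D:
  fixes M N :: "'a :: ab_group_add mat"
  assumes M: "M \<in> carrier_mat r c" and N: "N \<in> carrier_mat r c" and eq: "M + N = 0\<^sub>m r c"
  shows "M = - N"
proof (rule eq_matI)
  fix i j assume "i < dim_row (- N)" "j < dim_col (- N)"
  then show "M $$ (i, j) = (- N) $$ (i, j)"
    using arg_cong[OF eq, of "\<lambda>X. X $$ (i, j)"] M N by (simp add: add_eq_0_iff2)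
qed (use M N in auto)

lemma mat_add_uminus_add:
  fixes M N :: "'a :: ab_group_add mat"
  assumes "M \<in> carrier_mat r c" "N \<in> carrier_mat r c"
  shows "M + - (M + N) = - N"
  using assms by (intro eq_matI) auto

text \<open>
  Here \<open>T T\<^sup>*\<close> is the Gramian. With \<open>F = E T\<close> the Sylvester equation turns the Lyapunov expression into
  \<open>F (S + S\<^sup>*) F\<^sup>* + B L F\<^sup>* + F L\<^sup>* B\<^sup>* + B B\<^sup>*\<close>, and \<open>S + S\<^sup>* = L\<^sup>* L\<close> makes this the square
  \<open>(B + F L\<^sup>*) (B + F L\<^sup>*)\<^sup>*\<close>. A vanishing square has \<open>B = - F L\<^sup>*\<close>, and substituting this into the
  Sylvester equation gives the claim.
\<close>

lemma lyapunov_square_completion: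
  fixes A E B T S L :: "complex mat"
  assumes A: "A \<in> carrier_mat q q" and E: "E \<in> carrier_mat q q" and B: "B \<in> carrier_mat q m"
    and T: "T \<in> carrier_mat q q" and S: "S \<in> carrier_mat q q" and L: "L \<in> carrier_mat m q"
    and syl: "A * T = E * T * S + B * L"
    and SL: "S + mat_adjoint S = mat_adjoint L * L"
    and lyap: "A * (T * mat_adjoint T) * mat_adjoint E + E * (T * mat_adjoint T) * mat_adjoint A
      + B * mat_adjoint B = 0\<^sub>m q q"
  shows "A * T = - (E * T * mat_adjoint S)"
proof -
  let ?F = "E * T"
  let ?D = "B + ?F * mat_adjoint L"
  have F: "?F \<in> carrier_mat q q" using E T by auto
  have car: "mat_adjoint A \<in> carrier_mat q q" "mat_adjoint E \<in> carrier_mat q q"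
    "mat_adjoint B \<in> carrier_mat m q" "mat_adjoint T \<in> carrier_mat q q" "mat_adjoint S \<in> carrier_mat q q"
    "mat_adjoint L \<in> carrier_mat q m" "mat_adjoint ?F \<in> carrier_mat q q"
    using A E B T S L F by (metis mat_adjoint_carrier)+
  note [simp] = car
  have 1: "A * (T * mat_adjoint T) * mat_adjoint E = (A * T) * mat_adjoint ?F"
    unfolding mat_adjoint_mult[OF E T] by (rule assoc_mult_mat_inner[OF A T car(4,2)])
  have 2: "E * (T * mat_adjoint T) * mat_adjoint A = ?F * mat_adjoint (A * T)"
    unfolding mat_adjoint_mult[OF A T] by (rule assoc_mult_mat_inner[OF E T car(4,1)])
  have 3: "(A * T) * mat_adjoint ?F = ?F * S * mat_adjoint ?F + B * L * mat_adjoint ?F"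
    unfolding syl by (rule add_mult_distrib_mat[OF mult_carrier_mat[OF F S] mult_carrier_mat[OF B L] car(7)])
  have 4: "?F * mat_adjoint (A * T) = ?F * mat_adjoint S * mat_adjoint ?F + ?F * mat_adjoint L * mat_adjoint B"
  proof -
    have "mat_adjoint (A * T) = mat_adjoint S * mat_adjoint ?F + mat_adjoint L * mat_adjoint B"
      unfolding syl mat_adjoint_add[OF mult_carrier_mat[OF F S] mult_carrier_mat[OF B L]]
        mat_adjoint_mult[OF F S] mat_adjoint_mult[OF B L] ..
    then show ?thesis
      using mult_add_distrib_mat[OF F mult_carrier_mat[OF car(5,7)] mult_carrier_mat[OF car(6,3)]]
        assoc_mult_mat[OF F car(5,7)] assoc_mult_mat[OF F car(6,3)] by metis
  qed
  have 5: "?F * S * mat_adjoint ?F + ?F * mat_adjoint S * mat_adjoint ?F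
      = ?F * mat_adjoint L * (L * mat_adjoint ?F)"
  proof -
    have "?F * S * mat_adjoint ?F + ?F * mat_adjoint S * mat_adjoint ?F = ?F * (S + mat_adjoint S) * mat_adjoint ?F"
      using F S by (simp add: mult_add_distrib_mat[of _ q q _ q] add_mult_distrib_mat[of _ q q _ _ q])
    also have "\<dots> = ?F * mat_adjoint L * (L * mat_adjoint ?F)"
      unfolding SL by (rule assoc_mult_mat_inner[OF F car(6) L car(7)])
    finally show ?thesis .
  qed
  have "?D * mat_adjoint ?D = ?D * (mat_adjoint B + L * mat_adjoint ?F)"
    using B F L by (simp add: mat_adjoint_add[of _ q m] mat_adjoint_mult[of ?F q q _ m])
  also have "\<dots> = B * mat_adjoint B + B * L * mat_adjoint ?F
      + (?F * mat_adjoint L * mat_adjoint B + ?F * mat_adjoint L * (L * mat_adjoint ?F))"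
  proof -
    have FL: "?F * mat_adjoint L \<in> carrier_mat q m" and LF: "L * mat_adjoint ?F \<in> carrier_mat m q"
      using F L car by auto
    have "?D * (mat_adjoint B + L * mat_adjoint ?F) = B * (mat_adjoint B + L * mat_adjoint ?F)
        + ?F * mat_adjoint L * (mat_adjoint B + L * mat_adjoint ?F)"
      by (rule add_mult_distrib_mat[OF B FL add_carrier_mat[OF LF]])
    also have "B * (mat_adjoint B + L * mat_adjoint ?F) = B * mat_adjoint B + B * L * mat_adjoint ?F"
      unfolding mult_add_distrib_mat[OF B car(3) LF] assoc_mult_mat[OF B L car(7)] ..
    also have "?F * mat_adjoint L * (mat_adjoint B + L * mat_adjoint ?F)
        = ?F * mat_adjoint L * mat_adjoint B + ?F * mat_adjoint L * (L * mat_adjoint ?F)"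
      by (rule mult_add_distrib_mat[OF FL car(3) LF])
    finally show ?thesis .
  qed
  also have "\<dots> = A * (T * mat_adjoint T) * mat_adjoint E + E * (T * mat_adjoint T) * mat_adjoint A
      + B * mat_adjoint B"
    unfolding 1 2 3 4 5[symmetric]
    by (rule mat_add_rearrange[OF mult_carrier_mat[OF B car(3)]
          mult_carrier_mat[OF mult_carrier_mat[OF B L] car(7)]
          mult_carrier_mat[OF mult_carrier_mat[OF F car(6)] car(3)]
          mult_carrier_mat[OF mult_carrier_mat[OF F S] car(7)]
          mult_carrier_mat[OF mult_carrier_mat[OF F car(5)] car(7)]])
  finally have DD: "?D * mat_adjoint ?D = 0\<^sub>m q q" unfolding lyap .
  have FL: "?F * mat_adjoint L \<in> carrier_mat q m" by (rule mult_carrier_mat[OF F car(6)])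
  have D0: "?D = 0\<^sub>m q m" by (rule mult_adjoint_eq_0D[OF add_carrier_mat[OF FL] DD])
  have Beq: "B = - (?F * mat_adjoint L)" by (rule mat_add_eq_0D[OF B FL D0])
  have "B * L = - (?F * mat_adjoint L * L)"
    unfolding Beq by (rule uminus_mult_left_mat) (use L in simp)
  also have "\<dots> = - (?F * S + ?F * mat_adjoint S)"
    unfolding assoc_mult_mat[OF F car(6) L] SL[symmetric] mult_add_distrib_mat[OF F S car(5)] ..
  finally show ?thesis
    unfolding syl by (simp only: mat_add_uminus_add[OF mult_carrier_mat[OF F S] mult_carrier_mat[OF F car(5)]])
qed

section \<open>Block matrices with scalar blocks\<close>

text \<open>
  The Kronecker product of \<open>f\<close> with the identity matrix of size \<open>m\<close>. All matrices that act on the columns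
  of the ADI basis from the right have this form, because the recursion treats the \<open>m\<close> columns of a block alike.
\<close>

definition kron_one :: "nat \<Rightarrow> nat \<Rightarrow> nat \<Rightarrow> (nat \<Rightarrow> nat \<Rightarrow> complex) \<Rightarrow> complex mat" where
  "kron_one m r c f = Matrix.mat (r * m) (c * m)
     (\<lambda>(x, y). if x mod m = y mod m then f (x div m) (y div m) else 0)"

lemma kron_one_carrier [simp]: "kron_one m r c f \<in> carrier_mat (r * m) (c * m)"
  by (simp add: kron_one_def)

lemma dim_kron_one [simp]: "dim_row (kron_one m r c f) = r * m" "dim_col (kron_one m r c f) = c * m"
  by (simp_all add: kron_one_def)

lemma block_index:
  assumes "x < (k :: nat) * m"
  shows "x div m < k" "x mod m < m" "m * (x div m) + x mod m = x"
proof -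
  have "0 < m" using assms by (cases m) auto
  then show "x div m < k" "x mod m < m" "m * (x div m) + x mod m = x"
    using assms by (auto simp: less_mult_imp_div_less)
qed

lemma sum_blocks:
  fixes g :: "nat \<Rightarrow> 'a :: comm_monoid_add"
  shows "(\<Sum>x<k * m. g x) = (\<Sum>j<k. \<Sum>b<m. g (j * m + b))"
proof -
  have "(\<Sum>b<m. g (j * m + b)) = sum g {j * m..<j * m + m}" for j
    by (simp add: sum.shift_bounds_nat_ivl atLeast0LessThan[symmetric] sum.atLeastLessThan_shift_0[of g "j * m"] add.commute)
  then show ?thesis by (simp add: sum.nat_group)
qed

lemma sum_block_residue:
  fixes f :: "nat \<Rightarrow> 'a :: comm_monoid_add"
  assumes "b < m"
  shows "(\<Sum>x<k * m. if x mod m = b then f x else 0) = (\<Sum>j<k. f (j * m + b))"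
  using assms unfolding sum_blocks by (intro sum.cong) (auto simp: sum.delta)

lemma mult_kron_one_index:
  assumes M: "M \<in> carrier_mat n (k * m)" and r: "r < n" and y: "y < c * m"
  shows "(M * kron_one m k c f) $$ (r, y) = (\<Sum>j<k. M $$ (r, j * m + y mod m) * f j (y div m))"
proof -
  have b: "y mod m < m" using y block_index by blast
  have "(M * kron_one m k c f) $$ (r, y)
      = (\<Sum>x<k * m. if x mod m = y mod m then M $$ (r, x) * f (x div m) (y div m) else 0)"
    using M r y by (auto simp: kron_one_def scalar_prod_def atLeast0LessThan intro!: sum.cong)
  also have "\<dots> = (\<Sum>j<k. M $$ (r, j * m + y mod m) * f j (y div m))"
    using b by (subst sum_block_residue) (auto intro!: sum.cong)
  finally show ?thesis .
qed

lemma kron_one_mult: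
  "kron_one m r k f * kron_one m k c g = kron_one m r c (\<lambda>i j. \<Sum>l<k. f i l * g l j)"
proof (rule eq_matI, goal_cases)
  case (1 x y)
  then have x: "x < r * m" and y: "y < c * m" by (auto simp: kron_one_def)
  have b: "y mod m < m" using y block_index by blast
  have lt: "l * m + y mod m < k * m" if "l < k" for l
    using that b mult_le_mono1[of "Suc l" k m] by simp
  have "(kron_one m r k f * kron_one m k c g) $$ (x, y)
      = (\<Sum>l<k. kron_one m r k f $$ (x, l * m + y mod m) * g l (y div m))"
    by (rule mult_kron_one_index[OF kron_one_carrier x y])
  also have "\<dots> = (\<Sum>l<k. (if x mod m = y mod m then f (x div m) l else 0) * g l (y div m))"
    using x b lt by (intro sum.cong refl) (simp add: kron_one_def)
  also have "\<dots> = kron_one m r c (\<lambda>i j. \<Sum>l<k. f i l * g l j) $$ (x, y)"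
    using x y by (cases "x mod m = y mod m") (simp_all add: kron_one_def)
  finally show ?case .
qed (auto simp: kron_one_def)

lemma kron_one_adjoint: "mat_adjoint (kron_one m r c f) = kron_one m c r (\<lambda>i j. cnj (f j i))"
  by (intro eq_matI) (auto simp: kron_one_def)

lemma kron_one_add: "kron_one m r c f + kron_one m r c g = kron_one m r c (\<lambda>i j. f i j + g i j)"
  by (intro eq_matI) (auto simp: kron_one_def)

lemma kron_one_cong:
  assumes "\<And>i j. i < r \<Longrightarrow> j < c \<Longrightarrow> f i j = g i j"
  shows "kron_one m r c f = kron_one m r c g"
  using assms by (intro eq_matI) (auto simp: kron_one_def less_mult_imp_div_less)

lemma kron_one_diag: "kron_one m k k (\<lambda>i j. if i = j then f i else 0) = mat_diag (k * m) (\<lambda>y. f (y div m))"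
  by (rule eq_matI) (auto simp: kron_one_def mat_diag_def, metis mod_mult_div_eq)

section \<open>The Sylvester equation of the ADI basis\<close>

definition adi_coeff :: "(nat \<Rightarrow> complex) \<Rightarrow> nat \<Rightarrow> complex" where
  "adi_coeff \<sigma> i = complex_of_real (sqrt (2 * Re (\<sigma> i)))"

text \<open>
  The triangular matrix \<open>S\<close> (before taking the Kronecker product) in the Sylvester equation of the ADI basis.
\<close>

definition adi_shift :: "(nat \<Rightarrow> complex) \<Rightarrow> nat \<Rightarrow> nat \<Rightarrow> complex" where
  "adi_shift \<sigma> i j = (if i < j then adi_coeff \<sigma> i * adi_coeff \<sigma> j else if i = j then \<sigma> i else 0)"

lemma cnj_adi_coeff [simp]: "cnj (adi_coeff \<sigma> i) = adi_coeff \<sigma> i"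
  by (simp add: adi_coeff_def)

lemma adi_coeff_square: "0 \<le> Re (\<sigma> i) \<Longrightarrow> adi_coeff \<sigma> i * adi_coeff \<sigma> i = \<sigma> i + cnj (\<sigma> i)"
  by (simp add: adi_coeff_def of_real_mult[symmetric] complex_add_cnj del: of_real_mult)

lemma adi_shift_plus_adjoint:
  assumes "\<forall>i<k. 0 < Re (\<sigma> i)" "i < k" "j < k"
  shows "adi_shift \<sigma> i j + cnj (adi_shift \<sigma> j i) = adi_coeff \<sigma> i * adi_coeff \<sigma> j"
  using assms by (auto simp: adi_shift_def adi_coeff_square less_imp_le)

text \<open>
  The normalization is possible because \<open>S + S\<^sup>* = \<alpha>\<^sup>* \<alpha>\<close> for the row \<open>\<alpha>\<close> of the coefficients: testing
  with an eigenvector \<open>v\<close> gives \<open>\<bar>\<alpha> v\<bar>\<^sup>2 = 2 Re (\<sigma> i) \<parallel>v\<parallel>\<^sup>2 > 0\<close>, so \<open>\<alpha> v\<close> does not vanish.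
\<close>

lemma adi_shift_eigenvector:
  assumes re: "\<forall>i<k. 0 < Re (\<sigma> i)" and i: "i < k"
  obtains y where "\<And>l. l < k \<Longrightarrow> (\<Sum>j<k. adi_shift \<sigma> l j * y j) = \<sigma> i * y l"
    "(\<Sum>j<k. adi_coeff \<sigma> j * y j) = 1"
proof -
  let ?S = "Matrix.mat k k (\<lambda>(l, j). adi_shift \<sigma> l j)"
  have S: "?S \<in> carrier_mat k k" by simp
  have ut: "upper_triangular ?S" by (auto simp: adi_shift_def)
  have "\<sigma> i \<in> set (diag_mat ?S)" using i by (auto simp: diag_mat_def adi_shift_def)
  then have "poly (char_poly ?S) (\<sigma> i) = 0"
    unfolding char_poly_upper_triangular[OF S ut] by (auto simp: poly_prod_list prod_list_zero_iff)
  then have "eigenvalue ?S (\<sigma> i)" using eigenvalue_root_char_poly[OF S] by simp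
  then obtain v where v: "v \<in> carrier_vec k" "v \<noteq> 0\<^sub>v k" "?S *\<^sub>v v = \<sigma> i \<cdot>\<^sub>v v"
    unfolding eigenvalue_def eigenvector_def by auto
  have ev: "(\<Sum>j<k. adi_shift \<sigma> l j * v $ j) = \<sigma> i * v $ l" if "l < k" for l
    using arg_cong[OF v(3), of "\<lambda>x::complex Matrix.vec. x $ l"] that v(1) by (simp add: scalar_prod_def atLeast0LessThan)
  define N where "N = (\<Sum>l<k. (cmod (v $ l))\<^sup>2)"
  define c where "c = (\<Sum>j<k. adi_coeff \<sigma> j * v $ j)"
  have Q: "(\<Sum>l<k. cnj (v $ l) * (\<Sum>j<k. adi_shift \<sigma> l j * v $ j)) = \<sigma> i * N"
  proof -
    have "(\<Sum>l<k. cnj (v $ l) * (\<Sum>j<k. adi_shift \<sigma> l j * v $ j)) = (\<Sum>l<k. \<sigma> i * (v $ l * cnj (v $ l)))"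
      using ev by (intro sum.cong) auto
    then show ?thesis unfolding N_def of_real_sum complex_norm_square sum_distrib_left .
  qed
  \<comment> \<open>Both summands of \<open>S + S\<^sup>*\<close> in the quadratic form are evaluated by the eigenvalue equation.\<close>
  have "cnj c * c = (\<Sum>l<k. \<Sum>j<k. cnj (v $ l) * (adi_coeff \<sigma> l * adi_coeff \<sigma> j) * v $ j)"
    unfolding c_def cnj_sum sum_product by (simp add: mult_ac)
  also have "\<dots> = (\<Sum>l<k. \<Sum>j<k. cnj (v $ l) * (adi_shift \<sigma> l j + cnj (adi_shift \<sigma> j l)) * v $ j)"
    using adi_shift_plus_adjoint[OF re] by (intro sum.cong refl) auto
  also have "\<dots> = (\<Sum>l<k. cnj (v $ l) * (\<Sum>j<k. adi_shift \<sigma> l j * v $ j))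
      + (\<Sum>j<k. \<Sum>l<k. cnj (v $ l) * cnj (adi_shift \<sigma> j l) * v $ j)"
    unfolding sum.swap[of "\<lambda>j l. cnj (v $ l) * cnj (adi_shift \<sigma> j l) * v $ j"]
    by (simp add: sum.distrib sum_distrib_left algebra_simps)
  also have "(\<Sum>j<k. \<Sum>l<k. cnj (v $ l) * cnj (adi_shift \<sigma> j l) * v $ j)
      = cnj (\<Sum>l<k. cnj (v $ l) * (\<Sum>j<k. adi_shift \<sigma> l j * v $ j))"
    by (simp add: sum_distrib_left mult_ac)
  finally have cc: "cnj c * c = (\<sigma> i + cnj (\<sigma> i)) * N" unfolding Q by (simp add: algebra_simps)
  have "\<exists>l<k. v $ l \<noteq> 0" using v(1,2) by (metis carrier_vecD eq_vecI index_zero_vec)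
  then have "0 < N" unfolding N_def by (auto intro!: sum_pos2)
  then have "c \<noteq> 0" using cc re[rule_format, OF i] by (auto simp: complex_add_cnj)
  show thesis
  proof (rule that[of "\<lambda>j. v $ j / c"])
    show "(\<Sum>j<k. adi_shift \<sigma> l j * (v $ j / c)) = \<sigma> i * (v $ l / c)" if "l < k" for l
      using ev[OF that] by (simp add: sum_divide_distrib[symmetric])
    show "(\<Sum>j<k. adi_coeff \<sigma> j * (v $ j / c)) = 1"
      using \<open>c \<noteq> 0\<close> by (simp add: sum_divide_distrib[symmetric] c_def)
  qed
qed

lemma adi_block_carrier:
  assumes A: "A \<in> carrier_mat n n" and E: "E \<in> carrier_mat n n" and B: "B \<in> carrier_mat n m"
    and det: "\<forall>i<k. Determinant.det (A - \<sigma> i \<cdot>\<^sub>m E) \<noteq> 0" and i: "i < k"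
  shows "adi_block A E B \<sigma> i \<in> carrier_mat n m"
  using i
proof (induction i)
  case 0
  have M: "A - \<sigma> 0 \<cdot>\<^sub>m E \<in> carrier_mat n n" using A E by auto
  show ?case using minv(1)[OF M det[rule_format, OF 0]] B by auto
next
  case (Suc i)
  have M: "A - \<sigma> (Suc i) \<cdot>\<^sub>m E \<in> carrier_mat n n" using A E by auto
  show ?case using minv(1)[OF M det[rule_format, OF Suc.prems]] Suc A E by auto
qed

text \<open>
  The recursion is a Moebius transformation of the pencil:
  \<open>1 + (\<sigma>' + cnj \<sigma>) (A - \<sigma>' E)\<^sup>-\<^sup>1 E = (A - \<sigma>' E)\<^sup>-\<^sup>1 (A + cnj \<sigma> E)\<close>. Multiplying by
  \<open>A - \<sigma>' E\<close> removes the inverse.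
\<close>

lemma adi_block_recursion:
  assumes A: "A \<in> carrier_mat n n" and E: "E \<in> carrier_mat n n" and B: "B \<in> carrier_mat n m"
    and det: "\<forall>i<k. Determinant.det (A - \<sigma> i \<cdot>\<^sub>m E) \<noteq> 0"
    and re: "\<forall>i<k. 0 < Re (\<sigma> i)" and i: "Suc i < k"
  defines "Z \<equiv> adi_block A E B \<sigma>"
  shows "adi_coeff \<sigma> i \<cdot>\<^sub>m (A * Z (Suc i) - \<sigma> (Suc i) \<cdot>\<^sub>m (E * Z (Suc i)))
    = adi_coeff \<sigma> (Suc i) \<cdot>\<^sub>m (A * Z i + cnj (\<sigma> i) \<cdot>\<^sub>m (E * Z i))"
proof -
  let ?s = "\<sigma> (Suc i)" and ?t = "cnj (\<sigma> i)"
  let ?M = "A - ?s \<cdot>\<^sub>m E" and ?r = "complex_of_real (sqrt (Re (\<sigma> (Suc i)) / Re (\<sigma> i)))"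
  have M: "?M \<in> carrier_mat n n" using A E by auto
  note I = minv[OF M det[rule_format, OF i]]
  have Z: "Z i \<in> carrier_mat n m" "Z (Suc i) \<in> carrier_mat n m"
    unfolding Z_def using adi_block_carrier[OF A E B det] Suc_lessD[OF i] i by blast+
  have r: "adi_coeff \<sigma> i * ?r = adi_coeff \<sigma> (Suc i)"
    using re[rule_format, OF i] re[rule_format, of i] i unfolding adi_coeff_def of_real_mult[symmetric] real_sqrt_mult[symmetric] by simp
  have MI: "?M * (1\<^sub>m n + (?s + ?t) \<cdot>\<^sub>m (minv ?M * E)) = A + ?t \<cdot>\<^sub>m E"
  proof -
    have "?M * (1\<^sub>m n + (?s + ?t) \<cdot>\<^sub>m (minv ?M * E)) = ?M + (?s + ?t) \<cdot>\<^sub>m (?M * (minv ?M * E))"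
      using M I(1) E by (subst mult_add_distrib_mat[of _ n n _ n]) (auto simp: mult_smult_distrib[of _ n n _ n])
    also have "?M * (minv ?M * E) = E"
      using assoc_mult_mat[OF M I(1) E] I(2) E by simp
    also have "?M + (?s + ?t) \<cdot>\<^sub>m E = A + ?t \<cdot>\<^sub>m E"
      using A E by (intro eq_matI) (auto simp: algebra_simps)
    finally show ?thesis .
  qed
  have G: "1\<^sub>m n + (?s + ?t) \<cdot>\<^sub>m (minv ?M * E) \<in> carrier_mat n n" using I(1) E by auto
  have "?M * Z (Suc i) = ?r \<cdot>\<^sub>m (?M * (1\<^sub>m n + (?s + ?t) \<cdot>\<^sub>m (minv ?M * E)) * Z i)"
    using A G Z M by (simp add: Z_def mult_smult_distrib[of _ n n _ m])
  also have "\<dots> = ?r \<cdot>\<^sub>m (A * Z i + ?t \<cdot>\<^sub>m (E * Z i))"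
    unfolding MI using A E Z by (simp add: add_mult_distrib_mat[of _ n n _ _ m] mult_smult_assoc_mat[of _ n n _ m])
  finally have "?M * Z (Suc i) = ?r \<cdot>\<^sub>m (A * Z i + ?t \<cdot>\<^sub>m (E * Z i))" .
  moreover have "?M * Z (Suc i) = A * Z (Suc i) - ?s \<cdot>\<^sub>m (E * Z (Suc i))"
    using A E Z by (simp add: minus_mult_distrib_mat[of _ n n _ _ m] mult_smult_assoc_mat[of _ n n _ m])
  ultimately have "A * Z (Suc i) - ?s \<cdot>\<^sub>m (E * Z (Suc i)) = ?r \<cdot>\<^sub>m (A * Z i + ?t \<cdot>\<^sub>m (E * Z i))" by simp
  then show ?thesis unfolding r[symmetric] using A E Z by (intro eq_matI) auto
qed

text \<open>
  By the recursion, \<open>(A - \<sigma> i E) Z i\<close> divided by its coefficient grows by \<open>(\<sigma> i + cnj (\<sigma> i)) E Z i\<close>, divided by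
  the same coefficient, from one step to the next. Since \<open>\<sigma> i + cnj (\<sigma> i)\<close> is the square of the coefficient, the
  increments have the symmetric form that makes \<open>S + S\<^sup>* = L\<^sup>* L\<close> hold.
\<close>

lemma adi_block_sylvester:
  assumes A: "A \<in> carrier_mat n n" and E: "E \<in> carrier_mat n n" and B: "B \<in> carrier_mat n m"
    and det: "\<forall>i<k. Determinant.det (A - \<sigma> i \<cdot>\<^sub>m E) \<noteq> 0"
    and re: "\<forall>i<k. 0 < Re (\<sigma> i)" and i: "i < k" and r: "r < n" and b: "b < m"
  defines "Z \<equiv> adi_block A E B \<sigma>"
  shows "(A * Z i) $$ (r, b) = \<sigma> i * (E * Z i) $$ (r, b)
    + adi_coeff \<sigma> i * (B $$ (r, b) + (\<Sum>j<i. adi_coeff \<sigma> j * (E * Z j) $$ (r, b)))"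
  using i
proof (induction i)
  case 0
  let ?M = "A - \<sigma> 0 \<cdot>\<^sub>m E"
  have M: "?M \<in> carrier_mat n n" using A E by auto
  note I = minv[OF M det[rule_format, OF 0]]
  have Z: "Z 0 \<in> carrier_mat n m"
    unfolding Z_def by (rule adi_block_carrier[OF A E B det 0])
  have "?M * Z 0 = adi_coeff \<sigma> 0 \<cdot>\<^sub>m B"
  proof -
    have "?M * Z 0 = adi_coeff \<sigma> 0 \<cdot>\<^sub>m (?M * (minv ?M * B))"
      using M I(1) B by (simp add: Z_def adi_coeff_def mult_smult_distrib[of _ n n _ m])
    also have "?M * (minv ?M * B) = B" using assoc_mult_mat[OF M I(1) B] I(2) B by simp
    finally show ?thesis .
  qed
  moreover have "?M * Z 0 = A * Z 0 - \<sigma> 0 \<cdot>\<^sub>m (E * Z 0)"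
    using A E Z by (simp add: minus_mult_distrib_mat[of _ n n _ _ m] mult_smult_assoc_mat[of _ n n _ m])
  ultimately have "(A * Z 0 - \<sigma> 0 \<cdot>\<^sub>m (E * Z 0)) $$ (r, b) = (adi_coeff \<sigma> 0 \<cdot>\<^sub>m B) $$ (r, b)" by simp
  then have "(A * Z 0) $$ (r, b) - \<sigma> 0 * (E * Z 0) $$ (r, b) = adi_coeff \<sigma> 0 * B $$ (r, b)"
    using A E B Z r b by (simp del: index_mult_mat(1))
  then show ?case by (simp add: algebra_simps)
next
  case (Suc i)
  have i: "i < k" using Suc.prems by simp
  have Z: "Z i \<in> carrier_mat n m" "Z (Suc i) \<in> carrier_mat n m"
    unfolding Z_def using adi_block_carrier[OF A E B det] Suc.prems i by blast+
  have a0: "adi_coeff \<sigma> i \<noteq> 0" using re[rule_format, OF i] by (simp add: adi_coeff_def)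
  have sq: "adi_coeff \<sigma> i * adi_coeff \<sigma> i = \<sigma> i + cnj (\<sigma> i)" using re[rule_format, OF i] by (simp add: adi_coeff_square)
  define e f S where "e = (E * Z i) $$ (r, b)" and "f = (E * Z (Suc i)) $$ (r, b)"
    and "S = B $$ (r, b) + (\<Sum>j<i. adi_coeff \<sigma> j * (E * Z j) $$ (r, b))"
  have IH: "(A * Z i) $$ (r, b) = \<sigma> i * e + adi_coeff \<sigma> i * S"
    using Suc.IH[OF i] unfolding e_def S_def .
  have "adi_coeff \<sigma> i * ((A * Z (Suc i)) $$ (r, b) - \<sigma> (Suc i) * f)
      = adi_coeff \<sigma> (Suc i) * ((A * Z i) $$ (r, b) + cnj (\<sigma> i) * e)"
    using arg_cong[OF adi_block_recursion[OF A E B det re Suc.prems, folded Z_def], of "\<lambda>M::complex mat. M $$ (r, b)"]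
      A E Z r b unfolding e_def f_def by (simp del: index_mult_mat(1))
  also have "\<dots> = adi_coeff \<sigma> (Suc i) * ((adi_coeff \<sigma> i * adi_coeff \<sigma> i) * e + adi_coeff \<sigma> i * S)"
    unfolding IH sq by (simp add: algebra_simps)
  also have "\<dots> = adi_coeff \<sigma> i * (adi_coeff \<sigma> (Suc i) * (S + adi_coeff \<sigma> i * e))"
    by (simp add: algebra_simps)
  finally have "(A * Z (Suc i)) $$ (r, b) - \<sigma> (Suc i) * f = adi_coeff \<sigma> (Suc i) * (S + adi_coeff \<sigma> i * e)"
    using a0 by simp
  moreover have "S + adi_coeff \<sigma> i * e = B $$ (r, b) + (\<Sum>j<Suc i. adi_coeff \<sigma> j * (E * Z j) $$ (r, b))"
    by (simp add: S_def e_def)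
  ultimately have "(A * Z (Suc i)) $$ (r, b) - \<sigma> (Suc i) * f = adi_coeff \<sigma> (Suc i)
      * (B $$ (r, b) + (\<Sum>j<Suc i. adi_coeff \<sigma> j * (E * Z j) $$ (r, b)))" by (simp only:)
  then show ?case unfolding f_def by (simp only: diff_eq_eq add.commute)
qed

lemma adi_basis_sylvester:
  assumes A: "A \<in> carrier_mat n n" and E: "E \<in> carrier_mat n n" and B: "B \<in> carrier_mat n m"
    and det: "\<forall>i<k. Determinant.det (A - \<sigma> i \<cdot>\<^sub>m E) \<noteq> 0"
    and re: "\<forall>i<k. 0 < Re (\<sigma> i)"
  defines "Z \<equiv> adi_basis A E B \<sigma> k"
  shows "A * Z = E * Z * kron_one m k k (adi_shift \<sigma>) + B * kron_one m 1 k (\<lambda>_. adi_coeff \<sigma>)"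
proof (rule eq_matI, goal_cases)
  case (1 r y)
  have Z: "Z \<in> carrier_mat n (k * m)" using A B by (simp add: Z_def adi_basis_def)
  have r: "r < n" and y: "y < k * m" using 1 B by (auto simp: kron_one_def)
  let ?i = "y div m" and ?b = "y mod m"
  note ib = block_index[OF y]
  let ?Z = "adi_block A E B \<sigma>"
  have col: "(M * Z) $$ (r, j * m + ?b) = (M * ?Z j) $$ (r, ?b)" if "j < k" "M \<in> carrier_mat n n" for j M
  proof -
    have "j * m + ?b < k * m" using that ib(2) mult_le_mono1[of "Suc j" k m] by simp
    moreover have "?Z j \<in> carrier_mat n m" by (rule adi_block_carrier[OF A E B det that(1)])
    ultimately show ?thesis using that(2) r ib(2) Z A B
      by (simp add: scalar_prod_def Z_def adi_basis_def)
  qed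
  have "(E * Z * kron_one m k k (adi_shift \<sigma>)) $$ (r, y)
      = (\<Sum>j<k. (E * ?Z j) $$ (r, ?b) * adi_shift \<sigma> j ?i)"
    using mult_kron_one_index[of "E * Z" n k m r y k "adi_shift \<sigma>"] E Z r y
    by (simp add: col del: index_mult_mat(1))
  also have "\<dots> = (\<Sum>j\<in>insert ?i {..<?i}. (E * ?Z j) $$ (r, ?b) * adi_shift \<sigma> j ?i)"
    using ib(1) by (intro sum.mono_neutral_right) (auto simp: adi_shift_def)
  also have "\<dots> = \<sigma> ?i * (E * ?Z ?i) $$ (r, ?b)
      + adi_coeff \<sigma> ?i * (\<Sum>j<?i. adi_coeff \<sigma> j * (E * ?Z j) $$ (r, ?b))"
    by (subst sum.insert) (auto simp: adi_shift_def sum_distrib_left mult_ac intro!: sum.cong)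
  finally have 1: "(E * Z * kron_one m k k (adi_shift \<sigma>)) $$ (r, y) = \<dots>" .
  have 2: "(B * kron_one m 1 k (\<lambda>_. adi_coeff \<sigma>)) $$ (r, y) = B $$ (r, ?b) * adi_coeff \<sigma> ?i"
    using mult_kron_one_index[of B n 1 m r y k] B r y by simp
  have 3: "(A * Z) $$ (r, y) = (A * ?Z ?i) $$ (r, ?b)"
    using col[OF ib(1) A] ib(3) by (simp add: mult.commute)
  have "E * Z * kron_one m k k (adi_shift \<sigma>) \<in> carrier_mat n (k * m)" 
      "B * kron_one m 1 k (\<lambda>_. adi_coeff \<sigma>) \<in> carrier_mat n (k * m)"
    using mult_carrier_mat[OF mult_carrier_mat[OF E Z] kron_one_carrier] mult_carrier_mat[OF B, of "kron_one m 1 k _" "k * m"]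
      kron_one_carrier[of m 1 k] by auto
  then have 4: "(E * Z * kron_one m k k (adi_shift \<sigma>) + B * kron_one m 1 k (\<lambda>_. adi_coeff \<sigma>)) $$ (r, y)
      = (E * Z * kron_one m k k (adi_shift \<sigma>)) $$ (r, y) + (B * kron_one m 1 k (\<lambda>_. adi_coeff \<sigma>)) $$ (r, y)"
    using r y by (intro index_add_mat(1)) (auto simp only: carrier_matD)
  show ?case
    unfolding 4 1 2 3 adi_block_sylvester[OF A E B det re ib(1) r ib(2)]
    by (simp only: algebra_simps)
qed (use A B kron_one_carrier[of m 1 k] kron_one_carrier[of m k k] in \<open>auto simp: adi_basis_def Z_def\<close>)

section \<open>Krylov subspaces and interpolation\<close>

lemma mult_mat_injective_cancel:
  fixes V M N :: "complex mat"
  assumes V: "V \<in> carrier_mat n q" and inj: "\<forall>c\<in>carrier_vec q. V *\<^sub>v c = 0\<^sub>v n \<longrightarrow> c = 0\<^sub>v q"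
    and M: "M \<in> carrier_mat q r" and N: "N \<in> carrier_mat q r" and eq: "V * M = V * N"
  shows "M = N"
proof (rule eq_matI)
  fix i j assume "i < dim_row N" "j < dim_col N"
  then have i: "i < q" and j: "j < r" using N by auto
  have c: "col M j \<in> carrier_vec q" "col N j \<in> carrier_vec q" using M N by auto
  have "V *\<^sub>v (col M j - col N j) = V *\<^sub>v col M j - V *\<^sub>v col N j"
    by (rule mult_minus_distrib_mat_vec[OF V c])
  also have "\<dots> = col (V * M) j - col (V * N) j"
    using col_mult2[OF V M j] col_mult2[OF V N j] by simp
  also have "\<dots> = 0\<^sub>v n" unfolding eq using V N j by auto
  finally have "col M j - col N j = 0\<^sub>v q" using inj c by (metis minus_carrier_vec)
  then have "(col M j - col N j) $ i = 0" using i by simp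
  then show "M $$ (i, j) = N $$ (i, j)" using M N i j by simp
qed (use M N in auto)

text \<open>
  The generators of the Krylov subspace side by side, in the column order of the ADI basis.
\<close>

definition krylov_matrix ::
  "complex mat \<Rightarrow> complex mat \<Rightarrow> complex mat \<Rightarrow> (nat \<Rightarrow> complex) \<Rightarrow> nat \<Rightarrow> complex mat" where
  "krylov_matrix A E B \<sigma> k = Matrix.mat (dim_row A) (k * dim_col B)
     (\<lambda>(r, c). (minv (A - \<sigma> (c div dim_col B) \<cdot>\<^sub>m E) * B) $$ (r, c mod dim_col B))"

lemma in_span_colsE:
  fixes X :: "complex mat"
  assumes X: "X \<in> carrier_mat n q"
    and v: "v \<in> LinearCombinations.module.span class_ring (module_vec TYPE(complex) n) (set (cols X))"
  obtains c where "c \<in> carrier_vec q" "v = X *\<^sub>v c"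
proof -
  interpret vec_space "TYPE(complex)" n .
  have sub: "set (cols X) \<subseteq> carrier_vec n" using cols_dim[of X] X by auto
  have "v \<in> span_list (cols X)" using v span_list_as_span[OF sub] by simp
  then obtain c where "v = lincomb_list c (cols X)" by (rule in_span_listE)
  also have "\<dots> = mat_of_cols n (cols X) *\<^sub>v Matrix.vec (length (cols X)) c"
    using sub by (intro lincomb_list_as_mat_mult) auto
  also have "mat_of_cols n (cols X) = X" using X by auto
  finally have "v = X *\<^sub>v Matrix.vec (length (cols X)) c" .
  then show thesis by (rule that[rotated]) (use X in simp)
qed

text \<open>
  Linear independence of the set of columns concerns coefficients attached to vectors; distinctness of the columns
  allows the coefficients to be attached to indices instead.
\<close>

lemma lin_indpt_cols_imp_injective:
  fixes V :: "complex mat"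
  assumes V: "V \<in> carrier_mat n q" and d: "distinct (cols V)"
    and li: "\<not> LinearCombinations.module.lin_dep class_ring (module_vec TYPE(complex) n) (set (cols V))"
    and c: "c \<in> carrier_vec q" and z: "V *\<^sub>v c = 0\<^sub>v n"
  shows "c = 0\<^sub>v q"
proof (rule eq_vecI)
  interpret vec_space "TYPE(complex)" n .
  fix i assume "i < dim_vec (0\<^sub>v q :: complex Matrix.vec)"
  then have i: "i < q" by simp
  have sub: "set (cols V) \<subseteq> carrier_vec n" using cols_dim[of V] V by auto
  have len: "length (cols V) = q" using V by simp
  let ?g = "\<lambda>v. c $ (THE j. j < q \<and> cols V ! j = v)"
  have g: "?g (cols V ! j) = c $ j" if "j < q" for j
  proof -
    have "(THE j'. j' < q \<and> cols V ! j' = cols V ! j) = j"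
      using that len nth_eq_iff_index_eq[OF d] by (intro the_equality) (simp, metis)
    then show ?thesis by simp
  qed
  have "lincomb ?g (set (cols V)) = lincomb_list (\<lambda>j. ?g (cols V ! j)) (cols V)"
    by (rule lincomb_as_lincomb_list_distinct[OF sub d])
  also have "\<dots> = mat_of_cols n (cols V) *\<^sub>v Matrix.vec (length (cols V)) (\<lambda>j. ?g (cols V ! j))"
    using sub by (intro lincomb_list_as_mat_mult) auto
  also have "mat_of_cols n (cols V) = V" using V by auto
  also have "Matrix.vec (length (cols V)) (\<lambda>j. ?g (cols V ! j)) = c"
    unfolding len using c g by (intro eq_vecI) auto
  finally have "lincomb ?g (set (cols V)) = 0\<^sub>v n" using z by simp
  moreover have "cols V ! i \<in> set (cols V)" using i len nth_mem by metis
  ultimately have "?g (cols V ! i) = 0"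
    using li unfolding lin_dep_def by (fastforce simp: class_field_def)
  then show "c $ i = 0\<^sub>v q $ i" using g i by simp
qed (use c in simp)

lemma krylov_eq_span_cols:
  assumes A: "A \<in> carrier_mat n n" and E: "E \<in> carrier_mat n n" and B: "B \<in> carrier_mat n m"
    and det: "\<forall>i<k. Determinant.det (A - \<sigma> i \<cdot>\<^sub>m E) \<noteq> 0"
  shows "krylov A E B \<sigma> k = LinearCombinations.module.span class_ring (module_vec TYPE(complex) n)
    (set (cols (krylov_matrix A E B \<sigma> k)))"
proof -
  let ?X = "krylov_matrix A E B \<sigma> k"
  let ?G = "\<lambda>i. minv (A - \<sigma> i \<cdot>\<^sub>m E) * B"
  have G: "?G i \<in> carrier_mat n m" if "i < k" for i
  proof -
    have "A - \<sigma> i \<cdot>\<^sub>m E \<in> carrier_mat n n" using A E by auto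
    from minv(1)[OF this] show ?thesis using det that B by auto
  qed
  have colX: "col ?X y = col (?G (y div m)) (y mod m)" if "y < k * m" for y
  proof -
    define H where "H = ?G (y div m)"
    have H: "H \<in> carrier_mat n m" unfolding H_def using G block_index(1)[OF that] by blast
    have "?X $$ (i, y) = H $$ (i, y mod m)" if "i < n" for i
      using that \<open>y < k * m\<close> A B unfolding krylov_matrix_def H_def by (simp del: index_mult_mat(1))
    then show ?thesis unfolding H_def[symmetric]
      using H A B that block_index(2)[OF that] by (intro eq_vecI) (auto simp: krylov_matrix_def)
  qed
  have "(\<Union>i<k. set (cols (?G i))) = (\<Union>i<k. \<Union>b<m. {col (?G i) b})"
    using G by (fastforce simp: cols_def)
  also have "\<dots> = (\<lambda>y. col ?X y) ` {..<k * m}"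
  proof (intro equalityI subsetI)
    fix v assume "v \<in> (\<Union>i<k. \<Union>b<m. {col (?G i) b})"
    then obtain i b where ib: "i < k" "b < m" "v = col (?G i) b" by auto
    have lt: "i * m + b < k * m" using ib mult_le_mono1[of "Suc i" k m] by simp
    have "v = col ?X (i * m + b)" using ib colX[OF lt] by simp
    then show "v \<in> (\<lambda>y. col ?X y) ` {..<k * m}" using lt by blast
  next
    fix v assume "v \<in> (\<lambda>y. col ?X y) ` {..<k * m}"
    then obtain y where y: "y < k * m" "v = col (?G (y div m)) (y mod m)" using colX by auto
    then show "v \<in> (\<Union>i<k. \<Union>b<m. {col (?G i) b})" using block_index[OF y(1)] by blast
  qed
  also have "\<dots> = set (cols ?X)"
    using B by (auto simp: cols_def krylov_matrix_def)
  finally show ?thesis using A by (simp add: krylov_def)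
qed

text \<open>
  Linear independence in a subspace agrees with linear independence in the ambient space, so both halves of the
  basis property become statements about matrices.
\<close>

lemma columns_form_basis_factorE:
  fixes V X :: "complex mat"
  assumes V: "V \<in> carrier_mat n q" and X: "X \<in> carrier_mat n q"
    and bas: "columns_form_basis V (LinearCombinations.module.span class_ring (module_vec TYPE(complex) n) (set (cols X)))"
  obtains R where "R \<in> carrier_mat q q" "V = X * R"
    "\<forall>c\<in>carrier_vec q. V *\<^sub>v c = 0\<^sub>v n \<longrightarrow> c = 0\<^sub>v q"
proof -
  interpret vec_space "TYPE(complex)" n .
  let ?U = "span (set (cols X))"
  have sub: "set (cols X) \<subseteq> carrier_vec n" using cols_dim[of X] X by auto
  have sU: "subspace class_ring ?U (module_vec TYPE(complex) n)" using span_is_subspace[OF sub] .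
  have vs: "vectorspace class_ring (subspace_vs n ?U)" using subspace_is_vs[OF sU] by simp
  have d: "distinct (cols V)" and
    b: "vectorspace.basis class_ring (subspace_vs n ?U) (set (cols V))"
    using bas V unfolding columns_form_basis_def by auto
  have b1: "\<not> LinearCombinations.module.lin_dep class_ring (subspace_vs n ?U) (set (cols V))"
    and b2: "set (cols V) \<subseteq> ?U"
    using b unfolding vectorspace.basis_def[OF vs] by auto
  have li: "lin_indpt (set (cols V))"
    using b1 span_li_not_depend(2)[OF b2 span_is_submodule[OF sub]] by simp
  have "\<exists>c. c \<in> carrier_vec q \<and> col V j = X *\<^sub>v c" if "j < q" for j
  proof -
    have "col V j \<in> ?U" using b2 V that by (auto simp: cols_def)
    then show ?thesis using in_span_colsE[OF X] by metis
  qed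
  then obtain c where c: "\<And>j. j < q \<Longrightarrow> c j \<in> carrier_vec q" "\<And>j. j < q \<Longrightarrow> col V j = X *\<^sub>v c j"
    by metis
  let ?R = "Matrix.mat q q (\<lambda>(i, j). c j $ i)"
  have colR: "col ?R j = c j" if "j < q" for j
    using c(1)[OF that] that by (intro eq_vecI) auto
  have "V = X * ?R"
  proof (rule eq_matI)
    fix i j assume "i < dim_row (X * ?R)" "j < dim_col (X * ?R)"
    then have ij: "i < n" "j < q" using X by auto
    have "V $$ (i, j) = col V j $ i" using V ij by simp
    also have "\<dots> = (X * ?R) $$ (i, j)" using ij X c(2) colR by simp
    finally show "V $$ (i, j) = (X * ?R) $$ (i, j)" .
  qed (use V X in auto)
  then show thesis
    using that[of ?R] lin_indpt_cols_imp_injective[OF V d li] by auto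
qed

text \<open>
  The shift matrix is diagonal, so the Sylvester equation decouples into one linear system with matrix
  \<open>A - \<sigma> i E\<close> for each column.
\<close>

lemma krylov_matrix_unique:
  assumes A: "A \<in> carrier_mat n n" and E: "E \<in> carrier_mat n n" and B: "B \<in> carrier_mat n m"
    and det: "\<forall>i<k. Determinant.det (A - \<sigma> i \<cdot>\<^sub>m E) \<noteq> 0" and q: "q = k * m" and X: "X \<in> carrier_mat n q"
    and syl: "A * X = E * X * mat_diag q (\<lambda>y. \<sigma> (y div m)) + B * kron_one m 1 k (\<lambda>_ _. 1)"
  shows "X = krylov_matrix A E B \<sigma> k"
proof (rule eq_matI)
  note X = X[unfolded q] and syl = syl[unfolded q]
  fix r y assume "r < dim_row (krylov_matrix A E B \<sigma> k)" "y < dim_col (krylov_matrix A E B \<sigma> k)"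
  then have r: "r < n" and y: "y < k * m" using A B by (auto simp: krylov_matrix_def)
  note ib = block_index[OF y]
  let ?i = "y div m" and ?b = "y mod m"
  let ?M = "A - \<sigma> ?i \<cdot>\<^sub>m E"
  have M: "?M \<in> carrier_mat n n" using A E by auto
  note I = minv[OF M det[rule_format, OF ib(1)]]
  have x: "col X y \<in> carrier_vec n" using X by auto
  have EX: "E * X \<in> carrier_mat n (k * m)" using E X by auto
  have "?M *\<^sub>v col X y = col B ?b"
  proof (rule eq_vecI)
    fix j assume "j < dim_vec (col B ?b)"
    then have j: "j < n" using B by simp
    have "(A * X) $$ (j, y) = \<sigma> ?i * (E * X) $$ (j, y) + B $$ (j, ?b)"
    proof -
      have "(B * kron_one m 1 k (\<lambda>_ _. 1)) $$ (j, y) = B $$ (j, ?b)"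
        using mult_kron_one_index[of B n 1 m j y k] B j y by simp
      moreover have "(E * X * mat_diag (k * m) (\<lambda>y. \<sigma> (y div m))) $$ (j, y) = (E * X) $$ (j, y) * \<sigma> ?i"
        unfolding mat_diag_mult_right[OF EX] using j y by (simp del: index_mult_mat(1))
      moreover have "(A * X) $$ (j, y) = (E * X * mat_diag (k * m) (\<lambda>y. \<sigma> (y div m))) $$ (j, y)
          + (B * kron_one m 1 k (\<lambda>_ _. 1)) $$ (j, y)"
        unfolding syl using j y B by (intro index_add_mat(1)) auto
      ultimately show ?thesis by (simp only: mult.commute)
    qed
    moreover have "(?M *\<^sub>v col X y) $ j = (A * X) $$ (j, y) - \<sigma> ?i * (E * X) $$ (j, y)"
    proof -
      have "?M * X = A * X - \<sigma> ?i \<cdot>\<^sub>m (E * X)"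
        using A E X by (simp add: minus_mult_distrib_mat[of _ n n _ _ "k * m"] mult_smult_assoc_mat[of _ n n _ "k * m"])
      then have "(?M * X) $$ (j, y) = (A * X) $$ (j, y) - \<sigma> ?i * (E * X) $$ (j, y)"
        using A E X j y by (simp del: index_mult_mat(1))
      moreover have "(?M * X) $$ (j, y) = (?M *\<^sub>v col X y) $ j"
        using A E X j y by simp
      ultimately show ?thesis by simp
    qed
    ultimately show "(?M *\<^sub>v col X y) $ j = col B ?b $ j" using j B ib(2) by simp
  qed (use A E B in auto)
  then have "minv ?M *\<^sub>v col B ?b = minv ?M *\<^sub>v (?M *\<^sub>v col X y)" by simp
  also have "\<dots> = col X y" using assoc_mult_mat_vec[OF I(1) M x] I(3) x by simp
  finally have "X $$ (r, y) = (minv ?M *\<^sub>v col B ?b) $ r" using X r y by simp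
  also have "\<dots> = (minv ?M * B) $$ (r, ?b)" using I(1) B r ib(2) by simp
  also have "\<dots> = krylov_matrix A E B \<sigma> k $$ (r, y)"
    using A B r y by (simp add: krylov_matrix_def)
  finally show "X $$ (r, y) = krylov_matrix A E B \<sigma> k $$ (r, y)" .
qed (use A B X q in \<open>auto simp: krylov_matrix_def\<close>)

lemma transfer_fun_shifted:
  assumes A: "A \<in> carrier_mat n n" and E: "E \<in> carrier_mat n n" and B: "B \<in> carrier_mat n m"
    and C: "C \<in> carrier_mat p n" and det: "Determinant.det (cmat A - s \<cdot>\<^sub>m cmat E) \<noteq> 0"
  shows "transfer_fun A E B C s = - (cmat C * (minv (cmat A - s \<cdot>\<^sub>m cmat E) * cmat B))"
proof -
  let ?M = "cmat A - s \<cdot>\<^sub>m cmat E"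
  have M: "?M \<in> carrier_mat n n" and cB: "cmat B \<in> carrier_mat n m" and cC: "cmat C \<in> carrier_mat p n"
    using A E B C by auto
  note I = minv[OF M det]
  have "s \<cdot>\<^sub>m cmat E - cmat A = - ?M" using A E by (intro eq_matI) auto
  then have "transfer_fun A E B C s = cmat C * - minv ?M * cmat B"
    unfolding transfer_fun_def using minv_uminus[OF M det] by simp
  also have "\<dots> = - (cmat C * minv ?M * cmat B)" using cC I(1) cB by simp
  finally show ?thesis unfolding assoc_mult_mat[OF cC I(1) cB] .
qed

text \<open>
  If the reduction sends Krylov generators to Krylov generators, then both sides of the interpolation
  condition at \<open>\<sigma> i\<close> are read off from the \<open>i\<close>-th block of columns.
\<close>

lemma krylov_basis_interpolation:
  assumes A: "A \<in> carrier_mat n n" and E: "E \<in> carrier_mat n n" and B: "B \<in> carrier_mat n m"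
    and V: "V \<in> carrier_mat n q" and Aq: "Aq \<in> carrier_mat q q" and Eq: "Eq \<in> carrier_mat q q"
    and Bq: "Bq \<in> carrier_mat q m"
    and eq: "krylov_matrix A E B \<sigma> k = V * krylov_matrix Aq Eq Bq \<sigma> k" and i: "i < k"
    and det: "Determinant.det (A - \<sigma> i \<cdot>\<^sub>m E) \<noteq> 0" and detq: "Determinant.det (Aq - \<sigma> i \<cdot>\<^sub>m Eq) \<noteq> 0"
  shows "minv (A - \<sigma> i \<cdot>\<^sub>m E) * B = V * (minv (Aq - \<sigma> i \<cdot>\<^sub>m Eq) * Bq)"
proof (rule eq_matI)
  have M: "A - \<sigma> i \<cdot>\<^sub>m E \<in> carrier_mat n n" and Mq: "Aq - \<sigma> i \<cdot>\<^sub>m Eq \<in> carrier_mat q q"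
    using A E Aq Eq by auto
  have G: "minv (A - \<sigma> i \<cdot>\<^sub>m E) * B \<in> carrier_mat n m" and Gq: "minv (Aq - \<sigma> i \<cdot>\<^sub>m Eq) * Bq \<in> carrier_mat q m"
    using minv(1)[OF M det] minv(1)[OF Mq detq] B Bq by auto
  show "dim_row (minv (A - \<sigma> i \<cdot>\<^sub>m E) * B) = dim_row (V * (minv (Aq - \<sigma> i \<cdot>\<^sub>m Eq) * Bq))"
    "dim_col (minv (A - \<sigma> i \<cdot>\<^sub>m E) * B) = dim_col (V * (minv (Aq - \<sigma> i \<cdot>\<^sub>m Eq) * Bq))"
    using carrier_matD[OF G] carrier_matD[OF mult_carrier_mat[OF V Gq]] by (simp_all only:)
  fix r b assume "r < dim_row (V * (minv (Aq - \<sigma> i \<cdot>\<^sub>m Eq) * Bq))" "b < dim_col (V * (minv (Aq - \<sigma> i \<cdot>\<^sub>m Eq) * Bq))"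
  then have r: "r < n" and b: "b < m" using carrier_matD[OF mult_carrier_mat[OF V Gq]] by (simp_all only:)
  have lt: "i * m + b < k * m" using i b mult_le_mono1[of "Suc i" k m] by simp
  have K: "krylov_matrix A E B \<sigma> k $$ (r, i * m + b) = (minv (A - \<sigma> i \<cdot>\<^sub>m E) * B) $$ (r, b)"
    using A B r b lt by (simp add: krylov_matrix_def del: index_mult_mat(1))
  have Kq: "krylov_matrix Aq Eq Bq \<sigma> k $$ (l, i * m + b) = (minv (Aq - \<sigma> i \<cdot>\<^sub>m Eq) * Bq) $$ (l, b)" if "l < q" for l
    using Aq Bq that b lt by (simp add: krylov_matrix_def del: index_mult_mat(1))
  have Kc: "krylov_matrix Aq Eq Bq \<sigma> k \<in> carrier_mat q (k * m)" using Aq Bq by (simp add: krylov_matrix_def)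
  have "(minv (A - \<sigma> i \<cdot>\<^sub>m E) * B) $$ (r, b) = (\<Sum>l<q. V $$ (r, l) * (minv (Aq - \<sigma> i \<cdot>\<^sub>m Eq) * Bq) $$ (l, b))"
    unfolding K[symmetric] eq index_mult_mat_sum[OF V Kc r lt] by (intro sum.cong refl) (simp only: Kq lessThan_iff)
  then show "(minv (A - \<sigma> i \<cdot>\<^sub>m E) * B) $$ (r, b) = (V * (minv (Aq - \<sigma> i \<cdot>\<^sub>m Eq) * Bq)) $$ (r, b)"
    unfolding index_mult_mat_sum[OF V Gq r b] .
qed

section \<open>The reduced pencil\<close>

lemma injective_imp_det_nonzero:
  fixes M :: "complex mat"
  assumes M: "M \<in> carrier_mat q q" and "\<And>c. c \<in> carrier_vec q \<Longrightarrow> M *\<^sub>v c = 0\<^sub>v q \<Longrightarrow> c = 0\<^sub>v q"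
  shows "Determinant.det M \<noteq> 0"
  using assms det_0_iff_vec_prod_zero_field[OF M] by blast

text \<open>
  The injective \<open>V\<close> can be cancelled on the left, and after taking adjoints also on the right.
\<close>

lemma gramian_factor_unique:
  fixes V P T :: "complex mat"
  assumes V: "V \<in> carrier_mat n q" and inj: "\<forall>c\<in>carrier_vec q. V *\<^sub>v c = 0\<^sub>v n \<longrightarrow> c = 0\<^sub>v q"
    and P: "P \<in> carrier_mat q q" and T: "T \<in> carrier_mat q q"
    and eq: "V * P * mat_adjoint V = (V * T) * mat_adjoint (V * T)"
  shows "P = T * mat_adjoint T"
proof -
  let ?G = "T * mat_adjoint T"
  have V': "mat_adjoint V \<in> carrier_mat q n" and T': "mat_adjoint T \<in> carrier_mat q q"
    and G: "?G \<in> carrier_mat q q" and P': "mat_adjoint P \<in> carrier_mat q q"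
    using V T P by auto
  have "V * (P * mat_adjoint V) = V * (?G * mat_adjoint V)"
    using eq unfolding mat_adjoint_mult[OF V T] assoc_mult_mat[OF V P V']
      assoc_mult_mat[OF V T mult_carrier_mat[OF T' V']] assoc_mult_mat[OF T T' V'] .
  then have "P * mat_adjoint V = ?G * mat_adjoint V"
    by (rule mult_mat_injective_cancel[OF V inj mult_carrier_mat[OF P V'] mult_carrier_mat[OF G V']])
  then have "V * mat_adjoint P = V * ?G"
    using arg_cong[of _ _ mat_adjoint] mat_adjoint_mult[OF P V'] mat_adjoint_mult[OF G V']
      mat_adjoint_mult[OF T T'] by (metis mat_adjoint_adjoint)
  then have "mat_adjoint P = ?G" by (rule mult_mat_injective_cancel[OF V inj P' G])
  then have "mat_adjoint (mat_adjoint P) = mat_adjoint ?G" by simp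
  then show ?thesis using mat_adjoint_mult[OF T T'] by simp
qed

lemma reduce_sylvester:
  fixes A E B V U T S L :: "'a :: comm_ring_1 mat"
  assumes A: "A \<in> carrier_mat n n" and E: "E \<in> carrier_mat n n" and B: "B \<in> carrier_mat n m"
    and V: "V \<in> carrier_mat n q" and U: "U \<in> carrier_mat q n" and T: "T \<in> carrier_mat q r"
    and S: "S \<in> carrier_mat r r" and L: "L \<in> carrier_mat m r"
    and syl: "A * (V * T) = E * (V * T) * S + B * L"
  shows "(U * A * V) * T = (U * E * V) * T * S + (U * B) * L"
proof -
  have VT: "V * T \<in> carrier_mat n r" using V T by auto
  have EVT: "E * (V * T) \<in> carrier_mat n r" using E VT by auto
  have 1: "(U * M * V) * T = U * (M * (V * T))" if M: "M \<in> carrier_mat n n" for M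
    using assoc_mult_mat[OF mult_carrier_mat[OF U M] V T] assoc_mult_mat[OF U M VT] by simp
  have "U * (A * (V * T)) = U * (E * (V * T) * S) + U * (B * L)"
    unfolding syl by (rule mult_add_distrib_mat[OF U mult_carrier_mat[OF EVT S] mult_carrier_mat[OF B L]])
  then show ?thesis
    unfolding 1[OF A] 1[OF E] assoc_mult_mat[OF U EVT S] assoc_mult_mat[OF U B L] .
qed

text \<open>
  The matrix \<open>Q\<close> diagonalizes the reduced pencil, and \<open>X\<close> holds the coordinates of the Krylov generators in the
  basis \<open>V\<close>. Eigenvectors of the ADI shift matrix, normalized so that \<open>L\<close> maps them to 1, form a matrix \<open>Y\<close>
  for which \<open>Z Y\<close> solves the Sylvester equation that characterizes the Krylov matrix. Because the columns of \<open>V\<close>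
  are independent combinations of those of \<open>Z Y\<close>, all the square factors between \<open>V\<close>, \<open>Z\<close> and \<open>Z Y\<close> are
  invertible.
\<close>

lemma reduced_pencil_structure:
  fixes A E B V U P :: "complex mat"
  assumes A: "A \<in> carrier_mat n n" and E: "E \<in> carrier_mat n n" and B: "B \<in> carrier_mat n m"
    and det: "\<forall>i<k. Determinant.det (A - \<sigma> i \<cdot>\<^sub>m E) \<noteq> 0" and re: "\<forall>i<k. 0 < Re (\<sigma> i)"
    and q: "q = k * m" and V: "V \<in> carrier_mat n q" and bas: "columns_form_basis V (krylov A E B \<sigma> k)"
    and U: "U \<in> carrier_mat q n" and P: "P \<in> carrier_mat q q"
    and gram: "V * P * mat_adjoint V = adi_basis A E B \<sigma> k * mat_adjoint (adi_basis A E B \<sigma> k)"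
    and lyap: "(U * A * V) * P * mat_adjoint (U * E * V) + (U * E * V) * P * mat_adjoint (U * A * V)
      + (U * B) * mat_adjoint (U * B) = 0\<^sub>m q q"
  obtains Q X where
    "Q \<in> carrier_mat q q" "Determinant.det Q \<noteq> 0"
    "(U * A * V) * Q = (U * E * V) * Q * mat_diag q (\<lambda>y. - cnj (\<sigma> (y div m)))"
    "X \<in> carrier_mat q q"
    "A * (V * X) = E * (V * X) * mat_diag q (\<lambda>y. \<sigma> (y div m)) + B * kron_one m 1 k (\<lambda>_ _. 1)"
proof -
  let ?Z = "adi_basis A E B \<sigma> k" and ?S = "kron_one m k k (adi_shift \<sigma>)" and ?L = "kron_one m 1 k (\<lambda>_. adi_coeff \<sigma>)"
  let ?D = "mat_diag q (\<lambda>y. \<sigma> (y div m))" and ?K = "kron_one m 1 k (\<lambda>_ _. 1)"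
  let ?Aq = "U * A * V" and ?Eq = "U * E * V" and ?Bq = "U * B"
  have Z: "?Z \<in> carrier_mat n q" using A B q by (simp add: adi_basis_def)
  have S: "?S \<in> carrier_mat q q" unfolding q by simp
  have L: "?L \<in> carrier_mat m q" "?K \<in> carrier_mat m q" unfolding q using kron_one_carrier[of m 1 k] by simp_all
  have D: "?D \<in> carrier_mat q q" by simp
  have syl: "A * ?Z = E * ?Z * ?S + B * ?L" by (rule adi_basis_sylvester[OF A E B det re])
  \<comment> \<open>Column \<open>i\<close> of \<open>Y\<close> is the normalized eigenvector of the triangular matrix for \<open>\<sigma> i\<close>.\<close>
  have "\<forall>i<k. \<exists>y. (\<forall>l<k. (\<Sum>j<k. adi_shift \<sigma> l j * y j) = \<sigma> i * y l) \<and> (\<Sum>j<k. adi_coeff \<sigma> j * y j) = 1"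
    using adi_shift_eigenvector[OF re] by metis
  then obtain y where y: "\<And>i l. i < k \<Longrightarrow> l < k \<Longrightarrow> (\<Sum>j<k. adi_shift \<sigma> l j * y i j) = \<sigma> i * y i l"
    "\<And>i. i < k \<Longrightarrow> (\<Sum>j<k. adi_coeff \<sigma> j * y i j) = 1" by metis
  let ?Y = "kron_one m k k (\<lambda>l i. y i l)"
  have Y: "?Y \<in> carrier_mat q q" unfolding q by simp
  have D_eq: "?D = kron_one m k k (\<lambda>i j. if i = j then \<sigma> i else 0)" unfolding kron_one_diag q ..
  have SY: "?S * ?Y = ?Y * ?D"
    unfolding D_eq kron_one_mult
    by (rule kron_one_cong) (subst y(1), assumption, assumption, simp add: if_distrib sum.delta cong: if_cong)
  have LY: "?L * ?Y = ?K"
    unfolding kron_one_mult by (rule kron_one_cong) (simp add: y(2))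
  have ZY: "?Z * ?Y \<in> carrier_mat n q" and EZ: "E * ?Z \<in> carrier_mat n q" using Z Y E by auto
  have sylX: "A * (?Z * ?Y) = E * (?Z * ?Y) * ?D + B * ?K"
  proof -
    have "A * (?Z * ?Y) = (E * ?Z * ?S + B * ?L) * ?Y" unfolding syl[symmetric] using assoc_mult_mat[OF A Z Y] by simp
    also have "\<dots> = E * ?Z * ?S * ?Y + B * ?L * ?Y"
      by (rule add_mult_distrib_mat[OF mult_carrier_mat[OF EZ S] mult_carrier_mat[OF B L(1)] Y])
    also have "E * ?Z * ?S * ?Y = E * (?Z * ?Y) * ?D"
      unfolding assoc_mult_mat[OF EZ S Y] SY assoc_mult_mat[OF EZ Y D, symmetric] assoc_mult_mat[OF E Z Y] ..
    also have "B * ?L * ?Y = B * ?K" unfolding assoc_mult_mat[OF B L(1) Y] LY ..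
    finally show ?thesis .
  qed
  have X_eq: "?Z * ?Y = krylov_matrix A E B \<sigma> k"
    by (rule krylov_matrix_unique[OF A E B det q ZY sylX])
  obtain R where R: "R \<in> carrier_mat q q" and VR: "V = ?Z * ?Y * R"
    and inj: "\<forall>c\<in>carrier_vec q. V *\<^sub>v c = 0\<^sub>v n \<longrightarrow> c = 0\<^sub>v q"
    using columns_form_basis_factorE[OF V ZY bas[unfolded krylov_eq_span_cols[OF A E B det] X_eq[symmetric]]] by metis
  let ?N = "?Y * R"
  have N: "?N \<in> carrier_mat q q" using Y R by auto
  have VN: "V = ?Z * ?N" unfolding VR by (rule assoc_mult_mat[OF Z Y R])
  have detN: "Determinant.det ?N \<noteq> 0"
  proof (rule injective_imp_det_nonzero[OF N])
    fix c :: "complex Matrix.vec" assume c: "c \<in> carrier_vec q" "?N *\<^sub>v c = 0\<^sub>v q"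
    have "V *\<^sub>v c = ?Z *\<^sub>v (?N *\<^sub>v c)" using assoc_mult_mat_vec[OF Z N c(1)] VN by simp
    also have "\<dots> = 0\<^sub>v n" unfolding c(2) using Z by auto
    finally show "c = 0\<^sub>v q" using inj c(1) by blast
  qed
  then have detY: "Determinant.det ?Y \<noteq> 0" and detR: "Determinant.det R \<noteq> 0"
    using det_mult[OF Y R] by auto
  let ?T = "minv ?N"
  note T = minv[OF N detN] and Yi = minv[OF Y detY] and Ri = minv[OF R detR]
  have VT: "V * ?T = ?Z" using assoc_mult_mat[OF Z N T(1)] T(2) Z VN by simp
  have P_eq: "P = ?T * mat_adjoint ?T"
    by (rule gramian_factor_unique[OF V inj P T(1)]) (simp only: VT gram)
  have Aq: "?Aq \<in> carrier_mat q q" and Eq: "?Eq \<in> carrier_mat q q" and Bq: "?Bq \<in> carrier_mat q m"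
    using U A E B V by auto
  have sylT: "?Aq * ?T = ?Eq * ?T * ?S + ?Bq * ?L"
    by (rule reduce_sylvester[OF A E B V U T(1) S L(1)]) (simp only: VT syl)
  have SS: "?S + mat_adjoint ?S = mat_adjoint ?L * ?L"
    unfolding kron_one_adjoint kron_one_add kron_one_mult
    by (rule kron_one_cong) (use adi_shift_plus_adjoint[OF re] in simp)
  have AT: "?Aq * ?T = - (?Eq * ?T * mat_adjoint ?S)"
    by (rule lyapunov_square_completion[OF Aq Eq Bq T(1) S L(1) sylT SS]) (use lyap in \<open>simp only: P_eq\<close>)
  \<comment> \<open>The adjoint of \<open>S Y = Y D\<close> diagonalizes \<open>S\<^sup>*\<close> by the inverse of \<open>Y\<^sup>*\<close>.\<close>
  let ?Yi = "mat_adjoint (minv ?Y)" and ?Ya = "mat_adjoint ?Y" and ?D' = "mat_diag q (\<lambda>y. - cnj (\<sigma> (y div m)))"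
  have Yi': "?Yi \<in> carrier_mat q q" and Ya: "?Ya \<in> carrier_mat q q" and Sa: "mat_adjoint ?S \<in> carrier_mat q q"
    and Da: "mat_adjoint ?D \<in> carrier_mat q q"
    using Yi(1) Y S D by (metis mat_adjoint_carrier)+
  have Y1: "?Ya * ?Yi = 1\<^sub>m q" "?Yi * ?Ya = 1\<^sub>m q"
    unfolding mat_adjoint_mult[OF Yi(1) Y, symmetric] mat_adjoint_mult[OF Y Yi(1), symmetric]
      Yi(2,3) mat_adjoint_one by (rule refl)+
  have SaYi: "mat_adjoint ?S * ?Yi = ?Yi * mat_adjoint ?D"
  proof -
    have "?Ya * mat_adjoint ?S = mat_adjoint ?D * ?Ya"
      using arg_cong[OF SY, of mat_adjoint] unfolding mat_adjoint_mult[OF S Y] mat_adjoint_mult[OF Y D] .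
    then have "?Yi * (?Ya * mat_adjoint ?S) * ?Yi = ?Yi * (mat_adjoint ?D * ?Ya) * ?Yi" by simp
    moreover have "?Yi * (?Ya * mat_adjoint ?S) = mat_adjoint ?S"
      unfolding assoc_mult_mat[OF Yi' Ya Sa, symmetric] Y1(2) by (rule left_mult_one_mat[OF Sa])
    moreover have "?Yi * (mat_adjoint ?D * ?Ya) * ?Yi = ?Yi * mat_adjoint ?D"
      unfolding assoc_mult_mat_inner[OF Yi' Da Ya Yi'] Y1(1) by (rule right_mult_one_mat[OF mult_carrier_mat[OF Yi' Da]])
    ultimately show ?thesis by simp
  qed
  have D': "?D' = - mat_adjoint ?D" by (rule eq_matI) (auto simp: mat_diag_def)
  let ?Q = "?T * ?Yi"
  have ET: "?Eq * ?T \<in> carrier_mat q q" using Eq T(1) by auto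
  have Q: "?Q \<in> carrier_mat q q" using T(1) Yi' by auto
  have "Determinant.det ?Q \<noteq> 0"
  proof (rule inverse_imp_det_nonzero[OF Q mult_carrier_mat[OF Ya N]])
    have "?Q * (?Ya * ?N) = ?T * (?Yi * ?Ya) * ?N"
      using assoc_mult_mat_inner[OF T(1) Yi' Ya N] by simp
    then show "?Q * (?Ya * ?N) = 1\<^sub>m q" unfolding Y1 using T by simp
  qed
  moreover have "?Aq * ?Q = ?Eq * ?Q * ?D'"
  proof -
    have "?Aq * ?Q = ?Aq * ?T * ?Yi" by (rule assoc_mult_mat[OF Aq T(1) Yi', symmetric])
    also have "\<dots> = - (?Eq * ?T * mat_adjoint ?S * ?Yi)"
      unfolding AT by (rule uminus_mult_left_mat) (simp only: carrier_matD[OF mult_carrier_mat[OF ET Sa]] carrier_matD[OF Yi'])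
    also have "?Eq * ?T * mat_adjoint ?S * ?Yi = ?Eq * ?Q * mat_adjoint ?D"
      unfolding assoc_mult_mat[OF ET Sa Yi'] SaYi assoc_mult_mat[OF ET Yi' Da, symmetric] assoc_mult_mat[OF Eq T(1) Yi'] ..
    also have "- (?Eq * ?Q * mat_adjoint ?D) = ?Eq * ?Q * ?D'"
      unfolding D' by (rule uminus_mult_right_mat[symmetric]) (simp only: carrier_matD[OF mult_carrier_mat[OF Eq Q]] carrier_matD[OF Da])
    finally show ?thesis .
  qed
  moreover have "V * minv R = ?Z * ?Y"
    unfolding VR assoc_mult_mat[OF ZY R Ri(1)] Ri(2) by (rule right_mult_one_mat[OF ZY])
  then have "A * (V * minv R) = E * (V * minv R) * ?D + B * ?K" using sylX by simp
  ultimately show thesis using that[OF Q _ _ Ri(1)] by blast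
qed

section \<open>Pseudo-optimality\<close>

theorem theorem3p5:
  fixes n m p k q :: nat
    and A E B C V W P\<^sub>q A\<^sub>q E\<^sub>q B\<^sub>q C\<^sub>q :: "real mat"
    and Z :: "complex mat"
    and \<sigma> :: "nat \<Rightarrow> complex"
  assumes "A \<in> carrier_mat n n" and "E \<in> carrier_mat n n" and "Determinant.det E \<noteq> 0"
    and "B \<in> carrier_mat n m"
    and "asymp_stable A E"
    and "inj_on \<sigma> {..<k}"
    and "\<forall>i<k. Re (\<sigma> i) > 0"
    and "cnj ` \<sigma> ` {..<k} \<subseteq> \<sigma> ` {..<k}"
    and "q = k * m"
    and "Z = adi_basis (cmat A) (cmat E) (cmat B) \<sigma> k"
    and "vectorspace.dim class_ring
           (subspace_vs n (krylov (cmat A) (cmat E) (cmat B) \<sigma> k)) = q"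
    and "V \<in> carrier_mat n q"
    and "columns_form_basis (cmat V) (krylov (cmat A) (cmat E) (cmat B) \<sigma> k)"
    and "W \<in> carrier_mat n q"
    and "A\<^sub>q = transpose_mat W * A * V"
    and "E\<^sub>q = transpose_mat W * E * V"
    and "B\<^sub>q = transpose_mat W * B"
    and "Determinant.det E\<^sub>q \<noteq> 0"
    and "P\<^sub>q \<in> carrier_mat q q"
    and "A\<^sub>q * P\<^sub>q * transpose_mat E\<^sub>q + E\<^sub>q * P\<^sub>q * transpose_mat A\<^sub>q + B\<^sub>q * transpose_mat B\<^sub>q
           = 0\<^sub>m q q"
    and "cmat (V * P\<^sub>q * transpose_mat V) = Z * mat_adjoint Z"
    and "C \<in> carrier_mat p n"
    and "C\<^sub>q = C * V"
  shows "h2_pseudo_optimal p m (transfer_fun A E B C) A\<^sub>q E\<^sub>q (transfer_fun A\<^sub>q E\<^sub>q B\<^sub>q C\<^sub>q)"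
proof -
  note A = assms(1) and E = assms(2) and detE = assms(3) and B = assms(4) and st = assms(5)
    and re = assms(7) and q = assms(9) and Z = assms(10) and V = assms(12) and bas = assms(13)
    and W = assms(14) and Aq = assms(15) and Eq = assms(16) and Bq = assms(17) and detEq = assms(18)
    and P = assms(19) and lyap = assms(20) and gram = assms(21) and C = assms(22) and Cq = assms(23)
  let ?A = "cmat A" and ?E = "cmat E" and ?B = "cmat B" and ?V = "cmat V" and ?U = "cmat (transpose_mat W)"
  let ?d = "\<lambda>l. - cnj (\<sigma> (l div m))"
  have car: "?A \<in> carrier_mat n n" "?E \<in> carrier_mat n n" "?B \<in> carrier_mat n m" "?V \<in> carrier_mat n q"
    "?U \<in> carrier_mat q n" "cmat P\<^sub>q \<in> carrier_mat q q"
    using A E B V W P by auto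
  have Aqc: "A\<^sub>q \<in> carrier_mat q q" and Eqc: "E\<^sub>q \<in> carrier_mat q q" and Bqc: "B\<^sub>q \<in> carrier_mat q m"
    and Cqc: "C\<^sub>q \<in> carrier_mat p q"
    unfolding Aq Eq Bq Cq using A E B V W C by auto
  have cAq: "cmat A\<^sub>q = ?U * ?A * ?V" and cEq: "cmat E\<^sub>q = ?U * ?E * ?V" and cBq: "cmat B\<^sub>q = ?U * ?B"
    and cCq: "cmat C\<^sub>q = cmat C * ?V"
    unfolding Aq Eq Bq Cq using A E B V W C by (simp_all add: cmat_mult)
  have detM: "Determinant.det (?A - \<sigma> i \<cdot>\<^sub>m ?E) \<noteq> 0" if "i < k" for i
    using re that by (intro pencil_det_shifted[OF A E detE st]) (simp add: less_imp_le)
  have lyapc: "(?U * ?A * ?V) * cmat P\<^sub>q * mat_adjoint (?U * ?E * ?V)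
      + (?U * ?E * ?V) * cmat P\<^sub>q * mat_adjoint (?U * ?A * ?V) + (?U * ?B) * mat_adjoint (?U * ?B) = 0\<^sub>m q q"
  proof -
    have "cmat (A\<^sub>q * P\<^sub>q * transpose_mat E\<^sub>q + E\<^sub>q * P\<^sub>q * transpose_mat A\<^sub>q + B\<^sub>q * transpose_mat B\<^sub>q)
        = cmat (A\<^sub>q * P\<^sub>q * transpose_mat E\<^sub>q) + cmat (E\<^sub>q * P\<^sub>q * transpose_mat A\<^sub>q) + cmat (B\<^sub>q * transpose_mat B\<^sub>q)"
      using Aqc Eqc Bqc P by (subst cmat_add[of _ q q] | simp)+
    moreover have "cmat (0\<^sub>m q q) = 0\<^sub>m q q" by (intro eq_matI) auto
    ultimately show ?thesis
      unfolding cAq[symmetric] cEq[symmetric] cBq[symmetric] mat_adjoint_cmat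
      using lyap Aqc Eqc Bqc P by (simp add: cmat_mult)
  qed
  have gramc: "?V * cmat P\<^sub>q * mat_adjoint ?V = adi_basis ?A ?E ?B \<sigma> k * mat_adjoint (adi_basis ?A ?E ?B \<sigma> k)"
    using gram V P unfolding Z mat_adjoint_cmat by (simp add: cmat_mult)
  obtain Q X where Q: "Q \<in> carrier_mat q q" "Determinant.det Q \<noteq> 0"
      "cmat A\<^sub>q * Q = cmat E\<^sub>q * Q * mat_diag q ?d"
    and X: "X \<in> carrier_mat q q"
      "?A * (?V * X) = ?E * (?V * X) * mat_diag q (\<lambda>y. \<sigma> (y div m)) + ?B * kron_one m 1 k (\<lambda>_ _. 1)"
    using reduced_pencil_structure[OF car(1-3) _ re q car(4) bas car(5,6) gramc lyapc] detM
    unfolding cAq cEq by metis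
  have cEqc: "cmat E\<^sub>q \<in> carrier_mat q q" and cAqc: "cmat A\<^sub>q \<in> carrier_mat q q" using Eqc Aqc by auto
  let ?J = "cmat (minv E\<^sub>q * A\<^sub>q)"
  have J: "?J \<in> carrier_mat q q" using minv(1)[OF Eqc detEq] Aqc by auto
  have simJ: "similar_mat ?J (mat_diag q ?d)"
    using similar_of_pencil_diagonalization[OF cAqc cEqc Q(1) mat_diag_dim _ Q(2,3)] detEq minv(1)[OF Eqc detEq] Aqc
    by (simp add: cmat_mult cmat_minv[OF Eqc detEq] cmat_det)
  have stq: "asymp_stable A\<^sub>q E\<^sub>q"
    unfolding asymp_stable_def
  proof (intro allI impI)
    fix \<mu> assume "eigenvalue ?J \<mu>"
    then obtain l where l: "l < q" "\<mu> = ?d l" using similar_diag_eigenvalue[OF J simJ] by blast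
    then have "l div m < k" using q block_index by blast
    then show "Re \<mu> < 0" using re l(2) by simp
  qed
  have interp: "transfer_fun A E B C (\<sigma> i) = transfer_fun A\<^sub>q E\<^sub>q B\<^sub>q C\<^sub>q (\<sigma> i)" if i: "i < k" for i
  proof -
    have detMq: "Determinant.det (cmat A\<^sub>q - \<sigma> j \<cdot>\<^sub>m cmat E\<^sub>q) \<noteq> 0" if "j < k" for j
      using re that by (intro pencil_det_shifted[OF Aqc Eqc detEq stq]) (simp add: less_imp_le)
    have cBqc: "cmat B\<^sub>q \<in> carrier_mat q m" and VX: "?V * X \<in> carrier_mat n q" and cC: "cmat C \<in> carrier_mat p n"
      using Bqc car(4) X(1) C by auto
    have K1: "kron_one m 1 k (\<lambda>_ _. 1) \<in> carrier_mat m q" unfolding q using kron_one_carrier[of m 1 k] by simp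
    have sylq: "cmat A\<^sub>q * X = cmat E\<^sub>q * X * mat_diag q (\<lambda>y. \<sigma> (y div m)) + cmat B\<^sub>q * kron_one m 1 k (\<lambda>_ _. 1)"
      unfolding cAq cEq cBq by (rule reduce_sylvester[OF car(1-5) X(1) mat_diag_dim K1 X(2)])
    have "?V * X = krylov_matrix ?A ?E ?B \<sigma> k"
      using krylov_matrix_unique[OF car(1-3) _ q VX X(2)] detM by blast
    moreover have "X = krylov_matrix (cmat A\<^sub>q) (cmat E\<^sub>q) (cmat B\<^sub>q) \<sigma> k"
      using krylov_matrix_unique[OF cAqc cEqc cBqc _ q X(1) sylq] detMq by blast
    ultimately have KK: "krylov_matrix ?A ?E ?B \<sigma> k = ?V * krylov_matrix (cmat A\<^sub>q) (cmat E\<^sub>q) (cmat B\<^sub>q) \<sigma> k" by simp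
    have I: "minv (?A - \<sigma> i \<cdot>\<^sub>m ?E) * ?B = ?V * (minv (cmat A\<^sub>q - \<sigma> i \<cdot>\<^sub>m cmat E\<^sub>q) * cmat B\<^sub>q)"
      by (rule krylov_basis_interpolation[OF car(1-4) cAqc cEqc cBqc KK i detM[OF i] detMq[OF i]])
    have Mq: "cmat A\<^sub>q - \<sigma> i \<cdot>\<^sub>m cmat E\<^sub>q \<in> carrier_mat q q" using cAqc cEqc by auto
    have "cmat C * (?V * (minv (cmat A\<^sub>q - \<sigma> i \<cdot>\<^sub>m cmat E\<^sub>q) * cmat B\<^sub>q))
        = cmat C\<^sub>q * (minv (cmat A\<^sub>q - \<sigma> i \<cdot>\<^sub>m cmat E\<^sub>q) * cmat B\<^sub>q)"
      unfolding cCq by (rule assoc_mult_mat[OF cC car(4) mult_carrier_mat[OF minv(1)[OF Mq detMq[OF i]] cBqc], symmetric])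
    then show ?thesis
      unfolding transfer_fun_shifted[OF A E B C detM[OF i]] transfer_fun_shifted[OF Aqc Eqc Bqc Cqc detMq[OF i]] I by simp
  qed
  let ?G = "transfer_fun A E B C" and ?Gq = "transfer_fun A\<^sub>q E\<^sub>q B\<^sub>q C\<^sub>q"
  have dimA: "dim_row A\<^sub>q = q" using Aqc by simp
  have inT: "?Gq \<in> systems_same_jordan p m A\<^sub>q E\<^sub>q"
  proof -
    obtain n_as where "jordan_nf ?J n_as"
      using char_poly_factorized[OF J] jordan_nf_exists[OF J] by blast
    then have "same_jordan_form ?J ?J" unfolding same_jordan_form_def by blast
    then show ?thesis
      unfolding systems_same_jordan_def dimA
      by (intro CollectI exI conjI) (rule refl Aqc Eqc Bqc Cqc detEq | assumption)+
  qed
  have "h2_norm (\<lambda>s. ?G s - ?Gq s) \<le> h2_norm (\<lambda>s. ?G s - H s)"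
    if H: "H \<in> systems_same_jordan p m A\<^sub>q E\<^sub>q" for H
  proof -
    obtain A' E' B' C' where H_eq: "H = transfer_fun A' E' B' C'"
      and A': "A' \<in> carrier_mat q q" and E': "E' \<in> carrier_mat q q" and B': "B' \<in> carrier_mat q m"
      and C': "C' \<in> carrier_mat p q" and detE': "Determinant.det E' \<noteq> 0"
      and jnf: "same_jordan_form (cmat (minv E' * A')) ?J"
      using H unfolding systems_same_jordan_def dimA by (elim CollectE exE conjE) (rule that)
    have J': "cmat (minv E' * A') \<in> carrier_mat q q" using minv(1)[OF E' detE'] A' by auto
    have sim': "similar_mat (cmat (minv E' * A')) (mat_diag q ?d)"
    proof -
      obtain n_as where "similar_mat (cmat (minv E' * A')) (jordan_matrix n_as)" "similar_mat ?J (jordan_matrix n_as)"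
        using jnf unfolding same_jordan_form_def jordan_nf_def by blast
      then show ?thesis by (rule similar_mat_trans[OF _ similar_mat_trans[OF similar_mat_sym simJ]])
    qed
    have st': "asymp_stable A' E'"
      unfolding asymp_stable_def
    proof (intro allI impI)
      fix \<mu> assume "eigenvalue (cmat (minv E' * A')) \<mu>"
      then obtain l where l: "l < q" "\<mu> = ?d l" using similar_diag_eigenvalue[OF J' sim'] by blast
      then have "l div m < k" using q block_index by blast
      then show "Re \<mu> < 0" using re l(2) by simp
    qed
    obtain \<rho> where \<rho>: "\<forall>a<p. \<forall>b<m. \<forall>s. (\<forall>l<q. s \<noteq> ?d l) \<longrightarrow>
        ?Gq s $$ (a, b) = (\<Sum>l<q. \<rho> a b l * (1 / (s - ?d l)))"
      by (rule transfer_fun_partial_fractions[OF Aqc Eqc detEq Bqc Cqc simJ])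
    obtain \<rho>' where \<rho>': "\<forall>a<p. \<forall>b<m. \<forall>s. (\<forall>l<q. s \<noteq> ?d l) \<longrightarrow>
        H s $$ (a, b) = (\<Sum>l<q. \<rho>' a b l * (1 / (s - ?d l)))"
      unfolding H_eq by (rule transfer_fun_partial_fractions[OF A' E' detE' B' C' sim'])
    have carG: "?G s \<in> carrier_mat p m" "?Gq s \<in> carrier_mat p m" "H s \<in> carrier_mat p m" for s
      using carrier_transfer_fun[of A E B C s] carrier_transfer_fun[of A\<^sub>q E\<^sub>q B\<^sub>q C\<^sub>q s]
        carrier_transfer_fun[of A' E' B' C' s] carrier_matD[OF B] carrier_matD[OF C] carrier_matD[OF Bqc]
        carrier_matD[OF Cqc] carrier_matD[OF B'] carrier_matD[OF C']
      unfolding H_eq by (simp_all only:)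
    have entry: "(?G s - ?Gq s) $$ (a, b) = ?G s $$ (a, b) - ?Gq s $$ (a, b)"
      "(?G s - H s) $$ (a, b) = ?G s $$ (a, b) - H s $$ (a, b)" if "a < p" "b < m" for a b s
      using that carG[of s] by simp_all
    \<comment> \<open>The error \<open>f\<close> vanishes at the shifts, and \<open>g\<close> has its poles at their mirror images.\<close>
    let ?f = "\<lambda>a b s. ?G s $$ (a, b) - ?Gq s $$ (a, b)" and ?g = "\<lambda>a b s. H s $$ (a, b) - ?Gq s $$ (a, b)"
    have spG: "stable_proper (\<lambda>s. ?G s $$ (a, b))" and spGq: "stable_proper (\<lambda>s. ?Gq s $$ (a, b))"
      and spH: "stable_proper (\<lambda>s. H s $$ (a, b))" if "a < p" "b < m" for a b
      unfolding H_eq using that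
      by (rule stable_proper_transfer_fun[OF A E detE st B C] stable_proper_transfer_fun[OF Aqc Eqc detEq stq Bqc Cqc]
          stable_proper_transfer_fun[OF A' E' detE' st' B' C'])+
    have le: "Re (\<integral>\<omega>. ?f a b (\<i> * complex_of_real \<omega>) * cnj (?f a b (\<i> * complex_of_real \<omega>)) \<partial>lborel)
        \<le> Re (\<integral>\<omega>. (?G (\<i> * complex_of_real \<omega>) $$ (a, b) - H (\<i> * complex_of_real \<omega>) $$ (a, b))
            * cnj (?G (\<i> * complex_of_real \<omega>) $$ (a, b) - H (\<i> * complex_of_real \<omega>) $$ (a, b)) \<partial>lborel)"
      if ab: "a < p" "b < m" for a b
    proof -
      have sf: "stable_proper (?f a b)" by (rule stable_proper_diff[OF spG[OF ab] spGq[OF ab]])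
      have sg: "stable_proper (?g a b)" by (rule stable_proper_diff[OF spH[OF ab] spGq[OF ab]])
      have g: "?g a b (\<i> * complex_of_real \<omega>)
          = (\<Sum>l<q. (\<rho>' a b l - \<rho> a b l) * (1 / (\<i> * complex_of_real \<omega> - ?d l)))" for \<omega>
      proof -
        have "\<forall>l<q. \<i> * complex_of_real \<omega> \<noteq> ?d l"
        proof (intro allI impI notI)
          fix l assume l: "l < q" "\<i> * complex_of_real \<omega> = ?d l"
          then have "l div m < k" using q block_index by blast
          then have "0 < Re (\<sigma> (l div m))" using re by blast
          moreover have "Re (\<i> * complex_of_real \<omega>) = Re (?d l)" using l(2) by (rule arg_cong)
          ultimately show False by simp
        qed
        then show ?thesis
          using \<rho> \<rho>' ab by (simp only: left_diff_distrib sum_subtractf)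
      qed
      have "(\<integral>\<omega>. ?f a b (\<i> * complex_of_real \<omega>) * cnj (?g a b (\<i> * complex_of_real \<omega>)) \<partial>lborel) = 0"
        unfolding g
      proof (rule axis_orthogonal_partial_fractions[OF sf])
        fix l assume "l < q"
        then have "l div m < k" using q block_index by blast
        then show "0 < Re (\<sigma> (l div m))" "?f a b (\<sigma> (l div m)) = 0" using re interp by auto
      qed
      from axis_norm_le_of_orthogonal[OF sf sg this] show ?thesis by (simp only: diff_diff_eq2 diff_add_cancel)
    qed
    have F1: "h2_norm (\<lambda>s. ?G s - ?Gq s) = sqrt (1 / (2 * pi) * (\<Sum>a<p. \<Sum>b<m. Re (\<integral>\<omega>.
        (?G (\<i> * complex_of_real \<omega>) - ?Gq (\<i> * complex_of_real \<omega>)) $$ (a, b)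
        * cnj ((?G (\<i> * complex_of_real \<omega>) - ?Gq (\<i> * complex_of_real \<omega>)) $$ (a, b)) \<partial>lborel)))"
    proof (rule h2_norm_entrywise)
      fix a b assume ab: "a < p" "b < m"
      show "integrable lborel (\<lambda>\<omega>. (?G (\<i> * complex_of_real \<omega>) - ?Gq (\<i> * complex_of_real \<omega>)) $$ (a, b)
        * cnj ((?G (\<i> * complex_of_real \<omega>) - ?Gq (\<i> * complex_of_real \<omega>)) $$ (a, b)))"
        unfolding entry[OF ab]
        by (rule stable_proper_integrable_axis[OF stable_proper_diff[OF spG[OF ab] spGq[OF ab]]
              stable_proper_diff[OF spG[OF ab] spGq[OF ab]]])
    qed (rule minus_carrier_mat[OF carG(2)])
    have F2: "h2_norm (\<lambda>s. ?G s - H s) = sqrt (1 / (2 * pi) * (\<Sum>a<p. \<Sum>b<m. Re (\<integral>\<omega>.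
        (?G (\<i> * complex_of_real \<omega>) - H (\<i> * complex_of_real \<omega>)) $$ (a, b)
        * cnj ((?G (\<i> * complex_of_real \<omega>) - H (\<i> * complex_of_real \<omega>)) $$ (a, b)) \<partial>lborel)))"
    proof (rule h2_norm_entrywise)
      fix a b assume ab: "a < p" "b < m"
      show "integrable lborel (\<lambda>\<omega>. (?G (\<i> * complex_of_real \<omega>) - H (\<i> * complex_of_real \<omega>)) $$ (a, b)
        * cnj ((?G (\<i> * complex_of_real \<omega>) - H (\<i> * complex_of_real \<omega>)) $$ (a, b)))"
        unfolding entry[OF ab]
        by (rule stable_proper_integrable_axis[OF stable_proper_diff[OF spG[OF ab] spH[OF ab]]
              stable_proper_diff[OF spG[OF ab] spH[OF ab]]])
    qed (rule minus_carrier_mat[OF carG(3)])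
    show ?thesis
      unfolding F1 F2
    proof (intro real_sqrt_le_mono mult_left_mono sum_mono)
      fix a b assume "a \<in> {..<p}" "b \<in> {..<m}"
      then have ab: "a < p" "b < m" by auto
      show "Re (\<integral>\<omega>. (?G (\<i> * complex_of_real \<omega>) - ?Gq (\<i> * complex_of_real \<omega>)) $$ (a, b)
          * cnj ((?G (\<i> * complex_of_real \<omega>) - ?Gq (\<i> * complex_of_real \<omega>)) $$ (a, b)) \<partial>lborel)
        \<le> Re (\<integral>\<omega>. (?G (\<i> * complex_of_real \<omega>) - H (\<i> * complex_of_real \<omega>)) $$ (a, b)
          * cnj ((?G (\<i> * complex_of_real \<omega>) - H (\<i> * complex_of_real \<omega>)) $$ (a, b)) \<partial>lborel)"
        unfolding entry[OF ab] by (rule le[OF ab])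
    qed simp
  qed
  then show ?thesis
    unfolding h2_pseudo_optimal_def is_arg_min_def using stq inT by (auto simp: not_less)
qed

end
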